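(* Let $X$ be a continuum belonging to one of the following classes of continua: \begin{itemize} \item hereditarily indecomposable continua, \item indecomposable continua without end points and with all proper and nondegenerate subcontinua being arcs, \item indecomposable continua with exactly two end points and with all proper and nondegenerate subcontinua being arcs. \end{itemize} Then, for each $p\in X$, $(X,p)$ does not have unique hyperspace $C(p,X)$ in the class of all continua.
   Context: A continuum is a nonempty compact connected metric space. $C(X)$ is the set of all subcontinua of $X$ (nonempty closed connected subsets), and for $p\in X$, $C(p,X)=\{A\in C(X):p\in A\}$, endowed with the Hausdorff metric. An arc is a space homeomorphic to $[0,1]$. A continuum $X$ is decomposable if $X=A\cup B$ for some $A,B\in C(X)\setminus\{X\}$, and indecomposable otherwise; it is hereditarily indecomposable if every $C\in C(X)$ is indecomposable. In this statement an end point of a continuum $X$ means a point $p\in X$ such that $C(p,X)$ is an arc. $(X,p)$ has unique hyperspace $C(p,X)$ in the class of all continua if for each continuum $Y$ and each $q\in Y$ such that $C(p,X)$ is homeomorphic to $C(q,Y)$, there is a homeomorphism $h:X\to Y$ with $h(p)=q$.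
   Formalization: The continuum X is additionally assumed to have more than one point; a one-point continuum is hereditarily indecomposable under the given definitions but does have unique hyperspace C(p,X), so the claim fails there. *)

theory Defs
  imports "HOL-Analysis.Analysis"
begin

definition continuum :: "'a metric \<Rightarrow> bool" where
  "continuum M \<longleftrightarrow>
     mspace M \<noteq> {} \<and> compact_space (mtopology_of M) \<and> connected_space (mtopology_of M)"

definition subcontinua :: "'a metric \<Rightarrow> 'a set set" where
  "subcontinua M =
     {A. A \<noteq> {} \<and> closedin (mtopology_of M) A \<and> connectedin (mtopology_of M) A}"

definition subcontinua_at :: "'a \<Rightarrow> 'a metric \<Rightarrow> 'a set set" where
  "subcontinua_at p M = {A \<in> subcontinua M. p \<in> A}"

text \<open>
  The value 0 off \<^term>\<open>subcontinua M\<close> is only there because \<^const>\<open>Metric_space\<close> requires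
  nonnegativity and symmetry of the distance on the whole type.
\<close>

definition hausdorff_dist :: "'a metric \<Rightarrow> 'a set \<Rightarrow> 'a set \<Rightarrow> real" where
  "hausdorff_dist M A B =
     (if A \<in> subcontinua M \<and> B \<in> subcontinua M
      then max (SUP a\<in>A. INF b\<in>B. mdist M a b) (SUP b\<in>B. INF a\<in>A. mdist M a b)
      else 0)"

lemma Metric_space_hausdorff_dist:
  assumes comp: "compact_space (mtopology_of M)"
  shows "Metric_space (subcontinua M) (hausdorff_dist M)"
proof -
  interpret Metric_space "mspace M" "mdist M" by simp
  define e where "e x B = (INF b\<in>B. mdist M x b)" for x B
  define h where "h A B = (SUP a\<in>A. e a B)" for A B
  have top: "mtopology_of M = mtopology" by (simp add: mtopology_of_def)
  have sub: "A \<subseteq> mspace M" if "A \<in> subcontinua M" for A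
    using that closedin_subset unfolding subcontinua_def by force
  have ne: "A \<noteq> {}" if "A \<in> subcontinua M" for A
    using that unfolding subcontinua_def by force
  have cl: "closedin mtopology A" if "A \<in> subcontinua M" for A
    using that top unfolding subcontinua_def by force
  have "mbounded (mspace M)"
    using comp compactin_imp_mbounded top by (simp add: compact_space_def)
  then obtain D where D: "\<And>x y. x \<in> mspace M \<Longrightarrow> y \<in> mspace M \<Longrightarrow> mdist M x y \<le> D"
    unfolding mbounded_alt by blast
  have bb: "bdd_below (mdist M x ` B)" for x B
    by (rule bdd_belowI[of _ 0]) auto
  have e0: "0 \<le> e x B" if "B \<in> subcontinua M" for x B
    unfolding e_def by (rule cINF_greatest) (use ne[OF that] in auto)
  have ele: "e x B \<le> mdist M x b" if "b \<in> B" for x b B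
    unfolding e_def by (rule cINF_lower[OF bb that])
  have eD: "e x B \<le> D" if "B \<in> subcontinua M" "x \<in> mspace M" for x B
  proof -
    note BM = that(1) and xM = that(2)
    obtain b where b: "b \<in> B" using ne[OF BM] by auto
    then show ?thesis using ele[OF b, of x] D[OF xM, of b] sub[OF BM] by force
  qed
  have ba: "bdd_above ((\<lambda>a. e a B) ` A)" if "A \<in> subcontinua M" "B \<in> subcontinua M" for A B
  proof (rule bdd_aboveI[of _ D])
    fix y assume "y \<in> (\<lambda>a. e a B) ` A"
    then obtain a where "a \<in> A" "y = e a B" by blast
    then show "y \<le> D" using eD[OF that(2)] sub[OF that(1)] by auto
  qed
  have hge: "e a B \<le> h A B" if "A \<in> subcontinua M" "B \<in> subcontinua M" "a \<in> A" for a A B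
    unfolding h_def by (rule cSUP_upper[OF that(3) ba[OF that(1,2)]])
  have h0: "0 \<le> h A B" if "A \<in> subcontinua M" "B \<in> subcontinua M" for A B
  proof -
    have "\<exists>a. a \<in> A" using ne[OF that(1)] by auto
    then show ?thesis using e0[OF that(2)] hge[OF that] order_trans by blast
  qed
  have tri: "h A C \<le> h A B + h B C"
    if A: "A \<in> subcontinua M" and B: "B \<in> subcontinua M" and C: "C \<in> subcontinua M" for A B C
    unfolding h_def[of A C]
  proof (rule cSUP_least)
    fix a assume a: "a \<in> A"
    have aM: "a \<in> mspace M" using sub[OF A] a by blast
    have "e a C - h B C \<le> mdist M a b" if b: "b \<in> B" for b
    proof -
      have "e a C - mdist M a b \<le> mdist M b c" if c: "c \<in> C" for c
        using ele[OF c, of a] triangle[OF aM, of b c] sub[OF B] sub[OF C] b c by force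
      then have "e a C - mdist M a b \<le> e b C"
        unfolding e_def[of b C] by (rule cINF_greatest[rotated]) (use ne[OF C] in auto)
      also have "\<dots> \<le> h B C" by (rule hge[OF B C b])
      finally show ?thesis by simp
    qed
    then have "e a C - h B C \<le> e a B"
      unfolding e_def[of a B] by (rule cINF_greatest[rotated]) (use ne[OF B] in auto)
    then show "e a C \<le> h A B + h B C" using hge[OF A B a] by simp
  qed (use ne[OF A] in auto)
  have sub0: "A \<subseteq> B" if A: "A \<in> subcontinua M" and B: "B \<in> subcontinua M" and h: "h A B \<le> 0" for A B
  proof
    fix a assume a: "a \<in> A"
    show "a \<in> B"
    proof (rule ccontr)
      assume "a \<notin> B"
      moreover have "a \<in> mspace M" using sub[OF A] a by blast
      ultimately obtain r where r: "r > 0" "disjnt B (mball a r)"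
        using cl[OF B] unfolding closedin_metric by blast
      have "r \<le> e a B" unfolding e_def
      proof (rule cINF_greatest)
        fix b assume "b \<in> B"
        with r(2) have "b \<notin> mball a r" unfolding disjnt_iff by blast
        then show "r \<le> mdist M a b"
          using \<open>a \<in> mspace M\<close> \<open>b \<in> B\<close> sub[OF B] by auto
      qed (use ne[OF B] in auto)
      then show False using hge[OF A B a] h r by simp
    qed
  qed
  have hd: "hausdorff_dist M A B = max (h A B) (h B A)"
    if "A \<in> subcontinua M" "B \<in> subcontinua M" for A B
    using that unfolding hausdorff_dist_def h_def e_def by (simp add: commute)
  have hself: "h A A = 0" if A: "A \<in> subcontinua M" for A
  proof -
    have "e a A = 0" if "a \<in> A" for a
      using ele[OF that, of a] e0[OF A, of a] sub[OF A] that by force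
    then show ?thesis unfolding h_def using ne[OF A] by simp
  qed
  show ?thesis
  proof
    fix A B
    show "0 \<le> hausdorff_dist M A B"
    proof (cases "A \<in> subcontinua M \<and> B \<in> subcontinua M")
      case True
      then show ?thesis using hd[of A B] h0[of A B] by simp
    qed (auto simp: hausdorff_dist_def)
    show "hausdorff_dist M A B = hausdorff_dist M B A"
    proof (cases "A \<in> subcontinua M \<and> B \<in> subcontinua M")
      case True
      then show ?thesis using hd[of A B] hd[of B A] by (simp add: max.commute)
    qed (auto simp: hausdorff_dist_def)
  next
    fix A B assume AB: "A \<in> subcontinua M" "B \<in> subcontinua M"
    show "hausdorff_dist M A B = 0 \<longleftrightarrow> A = B"
    proof
      assume "hausdorff_dist M A B = 0"
      then have "h A B \<le> 0" "h B A \<le> 0" using hd[OF AB] by linarith+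
      then show "A = B" using sub0 AB by blast
    next
      assume "A = B" then show "hausdorff_dist M A B = 0" using hd[OF AB] hself[OF AB(1)] by simp
    qed
  next
    fix A B C assume "A \<in> subcontinua M" "B \<in> subcontinua M" "C \<in> subcontinua M"
    then show "hausdorff_dist M A C \<le> hausdorff_dist M A B + hausdorff_dist M B C"
      using tri[of A B C] tri[of C B A] hd[of A B] hd[of B C] hd[of A C] by linarith
  qed
qed

definition hyperspace_at :: "'a \<Rightarrow> 'a metric \<Rightarrow> 'a set metric" where
  "hyperspace_at p M = metric (subcontinua_at p M, hausdorff_dist M)"

lemma Metric_space_hyperspace_at:
  assumes "continuum M"
  shows "Metric_space (subcontinua_at p M) (hausdorff_dist M)"
  using assms Metric_space.subspace[OF Metric_space_hausdorff_dist]
  unfolding continuum_def subcontinua_at_def by fastforce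

lemma mspace_hyperspace_at [simp]:
  "continuum M \<Longrightarrow> mspace (hyperspace_at p M) = subcontinua_at p M"
  by (simp add: hyperspace_at_def Metric_space.mspace_metric Metric_space_hyperspace_at)

lemma mdist_hyperspace_at [simp]:
  "continuum M \<Longrightarrow> mdist (hyperspace_at p M) = hausdorff_dist M"
  by (simp add: hyperspace_at_def Metric_space.mdist_metric Metric_space_hyperspace_at)

definition arc_space :: "'a topology \<Rightarrow> bool" where
  "arc_space T \<longleftrightarrow> T homeomorphic_space top_of_set {0..1::real}"

definition decomposable :: "'a metric \<Rightarrow> bool" where
  "decomposable M \<longleftrightarrow>
     (\<exists>A \<in> subcontinua M - {mspace M}. \<exists>B \<in> subcontinua M - {mspace M}. mspace M = A \<union> B)"

abbreviation indecomposable :: "'a metric \<Rightarrow> bool" where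
  "indecomposable M \<equiv> \<not> decomposable M"

definition hereditarily_indecomposable :: "'a metric \<Rightarrow> bool" where
  "hereditarily_indecomposable M \<longleftrightarrow> (\<forall>C \<in> subcontinua M. indecomposable (submetric M C))"

definition end_point :: "'a metric \<Rightarrow> 'a \<Rightarrow> bool" where
  "end_point M p \<longleftrightarrow> p \<in> mspace M \<and> arc_space (mtopology_of (hyperspace_at p M))"

definition degenerate :: "'a set \<Rightarrow> bool" where
  "degenerate A \<longleftrightarrow> (\<exists>a. A = {a})"

definition proper_subcontinua_arcs :: "'a metric \<Rightarrow> bool" where
  "proper_subcontinua_arcs M \<longleftrightarrow>
     (\<forall>A \<in> subcontinua M. A \<noteq> mspace M \<and> \<not> degenerate A \<longrightarrow>
        arc_space (subtopology (mtopology_of M) A))"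

text \<open>
  The class of all continua is represented by the continua \<open>N :: real metric\<close>: the points of
  such an \<open>N\<close> are real numbers, but its metric is arbitrary. By the following lemma every
  compact metric space, over whatever type, is isometric to one of these, so nothing is lost.
\<close>

lemma compact_metric_isometric_real_metric:
  fixes M :: "'a metric"
  assumes "compact_space (mtopology_of M)"
  shows "\<exists>(N :: real metric) f. bij_betw f (mspace M) (mspace N) \<and>
           (\<forall>x \<in> mspace M. \<forall>y \<in> mspace M. mdist N (f x) (f y) = mdist M x y)"
proof -
  interpret Metric_space "mspace M" "mdist M" by simp
  have "mtotally_bounded (mspace M)"
    using assms compactin_imp_mtotally_bounded by (simp add: mtopology_of_def compact_space_def)
  then have "\<forall>n::nat. \<exists>K. finite K \<and> K \<subseteq> mspace M \<and> mspace M \<subseteq> (\<Union>x\<in>K. mball x (1 / Suc n))"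
    unfolding mtotally_bounded_def by (meson divide_pos_pos of_nat_0_less_iff zero_less_Suc zero_less_one)
  then obtain K where K: "\<And>n::nat. finite (K n)" "\<And>n. K n \<subseteq> mspace M"
    "\<And>n. mspace M \<subseteq> (\<Union>x\<in>K n. mball x (1 / Suc n))" by metis
  define D where "D = (\<Union>n. K n)"
  have cD: "countable D" unfolding D_def using K(1) by (simp add: countable_finite)
  define c where "c x = {prod_encode (k, n) | k n. mdist M x (from_nat_into D k) < 1 / Suc n}" for x
  have "inj_on c (mspace M)"
  proof (rule inj_onI, rule ccontr)
    fix x y assume xy: "x \<in> mspace M" "y \<in> mspace M" "c x = c y" "x \<noteq> y"
    then have "mdist M x y > 0" by simp
    then obtain n where n: "1 / Suc n < mdist M x y / 2"
      using nat_approx_posE[of "mdist M x y / 2"] by auto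
    obtain z where z: "z \<in> K n" "x \<in> mball z (1 / Suc n)" using K(3)[of n] xy(1) by blast
    have "z \<in> D" using z D_def by blast
    then obtain k where k: "from_nat_into D k = z" using cD from_nat_into_surj by metis
    have zM: "z \<in> mspace M" and zx: "mdist M x z < 1 / Suc n" using z commute by auto
    then have "prod_encode (k, n) \<in> c x" unfolding c_def using k by blast
    then have "prod_encode (k, n) \<in> c y" using xy by simp
    then have "mdist M y z < 1 / Suc n" unfolding c_def using k by auto
    then show False using zx n triangle''[of x z y] commute[of z y] commute[of z x] xy zM
      by (smt (verit) field_sum_of_halves triangle')
  qed
  then have "mspace M \<lesssim> (UNIV::nat set set)" unfolding lepoll_def by blast
  then have "mspace M \<lesssim> (UNIV::real set)"
    using nat_sets_eqpoll_reals eqpoll_imp_lepoll lepoll_trans by blast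
  then obtain f :: "'a \<Rightarrow> real" where f: "inj_on f (mspace M)" unfolding lepoll_def by blast
  define g where "g = inv_into (mspace M) f"
  have g: "g (f x) = x" if "x \<in> mspace M" for x
    using f that by (simp add: g_def)
  have MS: "Metric_space (f ` mspace M) (\<lambda>u v. mdist M (g u) (g v))"
    by unfold_locales (auto simp: g commute triangle)
  let ?N = "metric (f ` mspace M, \<lambda>u v. mdist M (g u) (g v))"
  have "bij_betw f (mspace M) (mspace ?N)"
    using f by (simp add: Metric_space.mspace_metric[OF MS] bij_betw_def)
  moreover have "\<forall>x \<in> mspace M. \<forall>y \<in> mspace M. mdist ?N (f x) (f y) = mdist M x y"
    by (simp add: Metric_space.mdist_metric[OF MS] g)
  ultimately show ?thesis by blast
qed

definition unique_hyperspace_at :: "'a \<Rightarrow> 'a metric \<Rightarrow> bool" where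
  "unique_hyperspace_at p M \<longleftrightarrow>
     (\<forall>(N :: real metric) q. continuum N \<and> q \<in> mspace N \<and>
        mtopology_of (hyperspace_at p M) homeomorphic_space mtopology_of (hyperspace_at q N) \<longrightarrow>
        (\<exists>h. homeomorphic_map (mtopology_of M) (mtopology_of N) h \<and> h p = q))"

end

theory Submission
  imports Defs
begin

text \<open>
  In all three classes \<open>C(p, X)\<close> is an arc or a 2-cell, hence homeomorphic to \<open>C(q, [0, 1])\<close> with
  \<open>q = 0\<close> or \<open>q = 1/2\<close>, whereas the indecomposable \<open>X\<close> is not homeomorphic to \<open>[0, 1]\<close>.

  If \<open>C(p, X)\<close> is a chain, as for hereditarily indecomposable \<open>X\<close>, then boundary bumping leaves no
  gaps in it, so it is an arc. Otherwise the proper subcontinua containing \<open>p\<close> are arcs, closed under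
  unions by indecomposability, and each is uniquely \<open>L \<union> R\<close> with \<open>L\<close> and \<open>R\<close> on the two sides
  of \<open>p\<close>. Each side is a chain, and it becomes an arc after adding \<open>X\<close> if it is unbounded, that is,
  if its union is dense. At least one side is unbounded. Thus \<open>C(p, X)\<close> is the square with the far
  edges of the unbounded sides collapsed to the single point \<open>X\<close>, which is a 2-cell. The number of
  end points plays no role.
\<close>

section \<open>Subcontinua and the Hausdorff distance\<close>

text \<open>The proper subcontinua through \<open>p\<close> need not fit into one arc, and their
  union need not carry a coordinate compatible with the topology of X, since an unbounded side
  accumulates everywhere. Directions at \<open>p\<close> are therefore not defined by rays. Two arcs
  that meet only in \<open>p\<close> serve as a compass, and a member of one side is recognised by
  meeting the opposite arc only in \<open>p\<close>. Any comparison involves finitely many sets,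
  which lie in one common arc together with the compass.

  No inverse of a map into C(p, X) is examined directly. The maps start from a compact interval or
  square and end in a Hausdorff space, so it is enough to know that they are continuous and which
  points they identify.

  One-point X is excluded because C(p, X) is then a point, and a one-point C(q, Y) forces Y to be a
  point as well.\<close>

lemma subcontinua_subset: "A \<in> subcontinua X \<Longrightarrow> A \<subseteq> mspace X"
  unfolding subcontinua_def by (metis (no_types, lifting) closedin_subset mem_Collect_eq topspace_mtopology_of)

lemma hausdorff_dist_leI:
  assumes "A \<in> subcontinua X" "B \<in> subcontinua X"
    and AB: "\<And>a. a \<in> A \<Longrightarrow> \<exists>b\<in>B. mdist X a b \<le> e"
    and BA: "\<And>b. b \<in> B \<Longrightarrow> \<exists>a\<in>A. mdist X a b \<le> e"
  shows "hausdorff_dist X A B \<le> e"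
proof -
  have ne: "A \<noteq> {}" "B \<noteq> {}" using assms unfolding subcontinua_def by auto
  have bdd: "bdd_below (mdist X a ` B)" "bdd_below ((\<lambda>a. mdist X a b) ` A)" for a b
    by (auto intro!: bdd_belowI[of _ 0])
  have "(SUP a\<in>A. INF b\<in>B. mdist X a b) \<le> e"
    using AB cINF_lower2[OF bdd(1)] by (intro cSUP_least ne) metis
  moreover have "(SUP b\<in>B. INF a\<in>A. mdist X a b) \<le> e"
  proof (intro cSUP_least ne)
    fix b assume "b \<in> B"
    then obtain a where "a \<in> A" "mdist X a b \<le> e" using BA by blast
    then show "(INF a\<in>A. mdist X a b) \<le> e" using cINF_lower2[OF bdd(2)] by metis
  qed
  ultimately show ?thesis
    using assms by (simp add: hausdorff_dist_def)
qed

lemma hausdorff_dist_commute: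
  assumes "continuum X"
  shows "hausdorff_dist X A B = hausdorff_dist X B A"
  using assms Metric_space.commute[OF Metric_space_hausdorff_dist] unfolding continuum_def by blast

lemma hausdorff_dist_lessD:
  assumes X: "continuum X" and A: "A \<in> subcontinua X" and B: "B \<in> subcontinua X"
    and less: "hausdorff_dist X A B < e" and a: "a \<in> A"
  shows "\<exists>b\<in>B. mdist X a b < e"
proof -
  interpret Metric_space "mspace X" "mdist X" by simp
  have "compactin mtopology (mspace X)"
    using X by (simp add: continuum_def compact_space_def mtopology_of_def)
  then obtain D where D: "\<And>x y. x \<in> mspace X \<Longrightarrow> y \<in> mspace X \<Longrightarrow> mdist X x y \<le> D"
    using compactin_imp_mbounded unfolding mbounded_alt by metis
  have ne: "A \<noteq> {}" "B \<noteq> {}" using A B unfolding subcontinua_def by auto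
  have bdd: "bdd_below (mdist X a ` B)" for a
    by (auto intro!: bdd_belowI[of _ 0])
  obtain b0 where b0: "b0 \<in> B" using ne by blast
  \<comment> \<open>A real \<open>SUP\<close> bounds its members only if the family is bounded
    above; compactness supplies the bound \<open>D\<close>.\<close>
  have "bdd_above ((\<lambda>a. INF b\<in>B. mdist X a b) ` A)"
  proof (rule bdd_aboveI2)
    fix a assume "a \<in> A"
    then have "mdist X a b0 \<le> D" using D b0 A B subcontinua_subset by blast
    then show "(INF b\<in>B. mdist X a b) \<le> D"
      using cINF_lower2[OF bdd b0] by blast
  qed
  then have "(INF b\<in>B. mdist X a b) \<le> (SUP a\<in>A. INF b\<in>B. mdist X a b)"
    by (rule cSUP_upper[OF a])
  also have "\<dots> < e"
    using A B less by (simp add: hausdorff_dist_def)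
  finally show ?thesis
    using cINF_less_iff[OF ne(2) bdd] by blast
qed

lemma subcontinuum_mspace: "continuum X \<Longrightarrow> mspace X \<in> subcontinua X"
  using closedin_topspace[of "mtopology_of X"] connectedin_topspace[of "mtopology_of X"]
  by (simp add: continuum_def subcontinua_def)

lemma subcontinuum_singleton:
  assumes "p \<in> mspace X"
  shows "{p} \<in> subcontinua X"
proof -
  interpret Metric_space "mspace X" "mdist X" by simp
  have "closedin mtopology {p}"
    using assms closedin_Hausdorff_singleton Hausdorff_space_mtopology by fastforce
  then show ?thesis
    using assms unfolding subcontinua_def by (auto simp: mtopology_of_def)
qed

lemma subcontinuum_Un:
  assumes "A \<in> subcontinua X" "B \<in> subcontinua X" "A \<inter> B \<noteq> {}"
  shows "A \<union> B \<in> subcontinua X"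
  using assms unfolding subcontinua_def by (auto intro: connectedin_Un closedin_Un)

lemma Hausdorff_mtopology_of: "Hausdorff_space (mtopology_of X)"
  by (simp add: mtopology_of_def Metric_space.Hausdorff_space_mtopology)

lemma subcontinuum_compactin:
  assumes "continuum X" "A \<in> subcontinua X"
  shows "compactin (mtopology_of X) A"
  using assms unfolding continuum_def subcontinua_def by (auto intro: closedin_compact_space)

lemma subcontinuumI:
  assumes "compactin (mtopology_of X) A" "connectedin (mtopology_of X) A" "A \<noteq> {}"
  shows "A \<in> subcontinua X"
  using assms compactin_imp_closedin[OF Hausdorff_mtopology_of] unfolding subcontinua_def by blast

text \<open>Boundary bumping inside the compact connected Hausdorff space \<open>B\<close>: a
  smaller continuum can be enlarged without filling \<open>B\<close>. Every absence of gaps below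
  comes from here.\<close>

lemma intermediate_subcontinuum:
  assumes X: "continuum X" and A: "A \<in> subcontinua X" and B: "B \<in> subcontinua X" and "A \<subset> B"
  obtains Z where "Z \<in> subcontinua X" "A \<subset> Z" "Z \<subset> B"
proof -
  let ?T = "subtopology (mtopology_of X) B"
  have [simp]: "topspace ?T = B" using subcontinua_subset[OF B] by auto
  have "compact_space ?T"
    using subcontinuum_compactin[OF X B] compact_space_subtopology by blast
  moreover have "Hausdorff_space ?T"
    by (simp add: Hausdorff_mtopology_of Hausdorff_space_subtopology)
  moreover have "connected_space ?T"
    using B by (simp add: subcontinua_def connectedin_def)
  moreover have "compactin ?T A"
    using subcontinuum_compactin[OF X A] assms by (simp add: compactin_subtopology psubset_imp_subset)
  moreover have "connectedin ?T A"
    using A assms by (simp add: subcontinua_def connectedin_subtopology psubset_imp_subset)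
  moreover have "A \<noteq> {}"
    using A by (simp add: subcontinua_def)
  moreover have "openin ?T B"
    using openin_topspace[of ?T] \<open>topspace ?T = B\<close> by metis
  ultimately obtain Z where Z: "compactin ?T Z" "connectedin ?T Z" "A \<subset> Z" "Z \<subset> B"
    using intermediate_continuum_exists[of ?T A B] compact_imp_locally_compact_space \<open>A \<subset> B\<close>
    by (metis \<open>topspace ?T = B\<close> psubset_eq)
  then show thesis
    by (intro that[of Z] subcontinuumI) (auto simp: compactin_subtopology connectedin_subtopology)
qed

section \<open>Limits of chains of subcontinua\<close>

definition chain_of_sets :: "'a set set \<Rightarrow> bool" where
  "chain_of_sets \<D> \<longleftrightarrow> (\<forall>A\<in>\<D>. \<forall>B\<in>\<D>. A \<subseteq> B \<or> B \<subseteq> A)"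

text \<open>If no member fits into \<open>U\<close>, the closed sets \<open>D - U\<close> have the
  finite intersection property, because a finite nonempty part of a chain has a smallest member.
  Compactness then yields a point of the intersection outside \<open>U\<close>.\<close>

lemma chain_compact_Inter_subset_open:
  assumes comp: "compact_space T" and clo: "\<And>D. D \<in> \<D> \<Longrightarrow> closedin T D" and "\<D> \<noteq> {}"
    and ch: "chain_of_sets \<D>" and U: "openin T U" "\<Inter>\<D> \<subseteq> U"
  shows "\<exists>D\<in>\<D>. D \<subseteq> U"
proof (rule ccontr)
  assume neg: "\<not> ?thesis"
  let ?\<E> = "(\<lambda>D. D - U) ` \<D>"
  have "\<Inter>?\<E> \<noteq> {}"
  proof (rule comp[unfolded compact_space_fip, rule_format], intro conjI ballI allI impI)
    show "closedin T E" if "E \<in> ?\<E>" for E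
      using that clo U by (auto intro: closedin_diff)
    fix \<F> assume \<F>: "finite \<F> \<and> \<F> \<subseteq> ?\<E>"
    then obtain \<G> where \<G>: "finite \<G>" "\<G> \<subseteq> \<D>" "\<F> = (\<lambda>D. D - U) ` \<G>"
      by (meson finite_subset_image)
    show "\<Inter>\<F> \<noteq> {}"
    proof (cases "\<G> = {}")
      case False
      have "\<exists>D\<in>\<G>. \<forall>E\<in>\<G>. D \<subseteq> E"
        using \<G>(1) False \<G>(2)
      proof (induction rule: finite_ne_induct)
        case (insert D \<G>)
        then obtain E where E: "E \<in> \<G>" "\<forall>F\<in>\<G>. E \<subseteq> F" by auto
        then have "D \<subseteq> E \<or> E \<subseteq> D" using ch insert.prems by (auto simp: chain_of_sets_def)
        then show ?case
        proof
          assume "D \<subseteq> E"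
          then have "\<forall>F\<in>insert D \<G>. D \<subseteq> F" using E(2) by auto
          then show ?thesis by blast
        next
          assume "E \<subseteq> D"
          then have "\<forall>F\<in>insert D \<G>. E \<subseteq> F" using E(2) by auto
          then show ?thesis using E(1) by blast
        qed
      qed auto
      then obtain D where D: "D \<in> \<G>" "\<forall>E\<in>\<G>. D \<subseteq> E" by blast
      then obtain x where "x \<in> D" "x \<notin> U" using neg \<G>(2) by blast
      then have "x \<in> \<Inter>\<F>" using D(2) \<G>(3) by auto
      then show ?thesis by blast
    qed (use \<G>(3) in auto)
  qed
  then show False using U \<open>\<D> \<noteq> {}\<close> by auto
qed

text \<open>By normality a separation of the intersection spreads to disjoint open sets. A single
  member of the chain already lies in their union and would be disconnected.\<close>

lemma subcontinuum_Inter_chain: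
  assumes X: "continuum X" and sub: "\<D> \<subseteq> subcontinua X" and ne: "\<D> \<noteq> {}" and ch: "chain_of_sets \<D>"
  shows "\<Inter>\<D> \<in> subcontinua X"
proof -
  let ?T = "mtopology_of X"
  have comp: "compact_space ?T" using X by (simp add: continuum_def)
  have clo: "closedin ?T D" if "D \<in> \<D>" for D
    using that sub by (auto simp: subcontinua_def)
  note in_open = chain_compact_Inter_subset_open[OF comp clo ne ch]
  have I: "closedin ?T (\<Inter>\<D>)" using clo ne by blast
  have "\<Inter>\<D> \<noteq> {}"
  proof
    assume "\<Inter>\<D> = {}"
    then obtain D where "D \<in> \<D>" "D \<subseteq> {}" using in_open[of "{}"] by auto
    then show False using sub by (auto simp: subcontinua_def)
  qed
  moreover have "connectedin ?T (\<Inter>\<D>)"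
  proof (rule ccontr)
    assume "\<not> ?thesis"
    then obtain E1 E2 where E: "closedin ?T E1" "closedin ?T E2" "\<Inter>\<D> \<subseteq> E1 \<union> E2" "E1 \<inter> E2 \<inter> \<Inter>\<D> = {}"
       "E1 \<inter> \<Inter>\<D> \<noteq> {}" "E2 \<inter> \<Inter>\<D> \<noteq> {}"
      unfolding connectedin_closedin using closedin_subset[OF I] by auto
    have "normal_space ?T"
      by (simp add: comp compact_Hausdorff_or_regular_imp_normal_space Hausdorff_mtopology_of)
    moreover have "closedin ?T (E1 \<inter> \<Inter>\<D>)" "closedin ?T (E2 \<inter> \<Inter>\<D>)"
      using E(1,2) I by (auto intro: closedin_Int)
    moreover have "disjnt (E1 \<inter> \<Inter>\<D>) (E2 \<inter> \<Inter>\<D>)"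
      using E(4) unfolding disjnt_def by blast
    ultimately obtain U V where UV: "openin ?T U" "openin ?T V" "E1 \<inter> \<Inter>\<D> \<subseteq> U" "E2 \<inter> \<Inter>\<D> \<subseteq> V" "disjnt U V"
      unfolding normal_space_def by meson
    have "\<Inter>\<D> \<subseteq> U \<union> V" using E(3) UV(3,4) by blast
    then obtain D where D: "D \<in> \<D>" "D \<subseteq> U \<union> V" using in_open[of "U \<union> V"] UV(1,2) by blast
    then have "connectedin ?T D" using sub by (auto simp: subcontinua_def)
    moreover have "U \<inter> D \<noteq> {}" "V \<inter> D \<noteq> {}" using E(5,6) UV(3,4) D(1) by blast+
    moreover have "U \<inter> V \<inter> D = {}" using UV(5) by (auto simp: disjnt_def)
    ultimately show False
      using D(2) UV(1,2) unfolding connectedin by blast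
  qed
  ultimately show ?thesis using I by (simp add: subcontinua_def)
qed

lemma subcontinuum_closure_Union_chain:
  assumes sub: "\<D> \<subseteq> subcontinua X" and ne: "\<D> \<noteq> {}" and ch: "chain_of_sets \<D>"
  shows "mtopology_of X closure_of (\<Union>\<D>) \<in> subcontinua X"
proof -
  let ?T = "mtopology_of X"
  obtain D where D: "D \<in> \<D>" using ne by blast
  have "connectedin ?T (\<Union>\<D>)"
  proof -
    \<comment> \<open>Writing \<open>D \<union> E\<close> in place of \<open>E\<close> gives all
      members common points; in a chain \<open>D \<union> E\<close> is again a member.\<close>
    have "connectedin ?T (\<Union>((\<union>) D ` \<D>))"
    proof (rule connectedin_Union)
      fix S assume "S \<in> (\<union>) D ` \<D>"
      then obtain E where "E \<in> \<D>" "S = D \<union> E" by blast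
      then have "S \<in> \<D>" using ch D unfolding chain_of_sets_def by (metis sup.absorb1 sup.absorb2)
      then show "connectedin ?T S" using sub by (auto simp: subcontinua_def)
    next
      have "D \<noteq> {}" using D sub by (auto simp: subcontinua_def)
      then show "\<Inter>((\<union>) D ` \<D>) \<noteq> {}" by auto
    qed
    moreover have "\<Union>((\<union>) D ` \<D>) = \<Union>\<D>" using D by blast
    ultimately show ?thesis by simp
  qed
  moreover have "\<Union>\<D> \<noteq> {}" using D sub by (auto simp: subcontinua_def)
  moreover have "\<Union>\<D> \<subseteq> mspace X" using sub subcontinua_subset by blast
  ultimately show ?thesis
    unfolding subcontinua_def by (auto simp: connectedin_closure_of closure_of_eq_empty)
qed

text \<open>Hausdorff convergence of a decreasing chain to its intersection: the
  \<open>e\<close>-neighbourhood of the intersection is open, so it swallows a member.\<close>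

lemma Inter_chain_approx:
  assumes X: "continuum X" and sub: "\<D> \<subseteq> subcontinua X" and ne: "\<D> \<noteq> {}" and ch: "chain_of_sets \<D>"
    and e: "e > 0"
  shows "\<exists>D\<in>\<D>. \<forall>d\<in>D. \<exists>x\<in>\<Inter>\<D>. mdist X x d < e"
proof -
  interpret Metric_space "mspace X" "mdist X" by simp
  have "\<exists>D\<in>\<D>. D \<subseteq> (\<Union>x\<in>\<Inter>\<D>. mball x e)"
  proof (rule chain_compact_Inter_subset_open[of mtopology])
    show "compact_space mtopology" using X by (simp add: continuum_def mtopology_of_def)
    show "closedin mtopology D" if "D \<in> \<D>" for D
      using that sub by (auto simp: subcontinua_def mtopology_of_def)
    show "\<Inter>\<D> \<subseteq> (\<Union>x\<in>\<Inter>\<D>. mball x e)"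
      using e ne sub subcontinua_subset by blast
  qed (auto simp: ne ch)
  then obtain D where "D \<in> \<D>" "D \<subseteq> (\<Union>x\<in>\<Inter>\<D>. mball x e)" by blast
  moreover have "\<exists>x\<in>\<Inter>\<D>. mdist X x d < e" if "d \<in> (\<Union>x\<in>\<Inter>\<D>. mball x e)" for d
    using that by (auto simp only: UN_iff in_mball)
  ultimately show ?thesis by blast
qed

text \<open>The dual estimate, obtained from complements: for each member take the points at
  distance at least \<open>e\<close> from all of it. These closed sets form a chain whose
  intersection misses the closure, so one of them misses it already.\<close>

lemma closure_Union_chain_approx:
  assumes X: "continuum X" and sub: "\<D> \<subseteq> subcontinua X" and ne: "\<D> \<noteq> {}" and ch: "chain_of_sets \<D>"
    and e: "e > 0"
  shows "\<exists>D\<in>\<D>. \<forall>x \<in> mtopology_of X closure_of (\<Union>\<D>). \<exists>d\<in>D. mdist X d x < e"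
proof -
  interpret Metric_space "mspace X" "mdist X" by simp
  let ?C = "\<lambda>D. mspace X - (\<Union>x\<in>D. mball x e)"
  have "\<exists>E\<in>?C ` \<D>. E \<subseteq> mspace X - mtopology closure_of (\<Union>\<D>)"
  proof (rule chain_compact_Inter_subset_open[of mtopology])
    show "compact_space mtopology" using X by (simp add: continuum_def mtopology_of_def)
    show "closedin mtopology E" if "E \<in> ?C ` \<D>" for E
    proof -
      obtain D where "E = ?C D" using \<open>E \<in> ?C ` \<D>\<close> by blast
      moreover have "openin mtopology (\<Union>x\<in>D. mball x e)" by blast
      ultimately show ?thesis by (metis closedin_topspace closedin_diff topspace_mtopology)
    qed
    show "chain_of_sets (?C ` \<D>)" using ch unfolding chain_of_sets_def by blast
    show "openin mtopology (mspace X - mtopology closure_of (\<Union>\<D>))"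
      by (metis closedin_closure_of openin_diff openin_topspace topspace_mtopology)
    show "\<Inter>(?C ` \<D>) \<subseteq> mspace X - mtopology closure_of (\<Union>\<D>)"
    proof
      fix x assume x: "x \<in> \<Inter>(?C ` \<D>)"
      have "x \<notin> mtopology closure_of (\<Union>\<D>)"
      proof
        assume "x \<in> mtopology closure_of (\<Union>\<D>)"
        then obtain d D where "D \<in> \<D>" "d \<in> D" "d \<in> mball x e"
          using e unfolding metric_closure_of by blast
        moreover have "x \<in> ?C D" using x \<open>D \<in> \<D>\<close> by blast
        ultimately show False using commute[of x d] by auto
      qed
      then show "x \<in> mspace X - mtopology closure_of (\<Union>\<D>)" using x ne by blast
    qed
  qed (use ne in auto)
  then obtain D where D: "D \<in> \<D>" "?C D \<subseteq> mspace X - mtopology closure_of (\<Union>\<D>)" by blast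
  have "mtopology closure_of (\<Union>\<D>) \<subseteq> mspace X"
    using closure_of_subset_topspace by fastforce
  then have "\<exists>d\<in>D. mdist X d x < e" if "x \<in> mtopology closure_of (\<Union>\<D>)" for x
  proof -
    have "x \<in> (\<Union>x\<in>D. mball x e)" using D(2) that \<open>mtopology closure_of (\<Union>\<D>) \<subseteq> mspace X\<close> by blast
    then show ?thesis by (auto simp only: UN_iff in_mball)
  qed
  then show ?thesis using D(1) by (auto simp: mtopology_of_def)
qed

section \<open>Chains of subcontinua\<close>

lemma compact_metric_dense_sequence:
  fixes X :: "'a metric"
  assumes comp: "compact_space (mtopology_of X)" and ne: "mspace X \<noteq> {}"
  shows "\<exists>x::nat \<Rightarrow> 'a. range x \<subseteq> mspace X \<and> (\<forall>y\<in>mspace X. \<forall>e>0. \<exists>n. mdist X (x n) y < e)"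
proof -
  interpret Metric_space "mspace X" "mdist X" by simp
  have "mtotally_bounded (mspace X)"
    using comp compactin_imp_mtotally_bounded by (simp add: mtopology_of_def compact_space_def)
  then have "\<forall>n::nat. \<exists>K. finite K \<and> K \<subseteq> mspace X \<and> mspace X \<subseteq> (\<Union>x\<in>K. mball x (1 / Suc n))"
    unfolding mtotally_bounded_def by (meson divide_pos_pos of_nat_0_less_iff zero_less_Suc zero_less_one)
  then obtain K where K: "\<And>n::nat. finite (K n)" "\<And>n. K n \<subseteq> mspace X"
    "\<And>n. mspace X \<subseteq> (\<Union>x\<in>K n. mball x (1 / Suc n))" by metis
  let ?D = "\<Union>n. K n"
  have "countable ?D" using K(1) by (simp add: countable_finite)
  moreover have "?D \<noteq> {}" using K(3)[of 0] ne by blast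
  ultimately have x: "range (from_nat_into ?D) = ?D" by (intro range_from_nat_into)
  have "\<exists>n. mdist X (from_nat_into ?D n) y < e" if y: "y \<in> mspace X" and e: "e > 0" for y e
  proof -
    obtain n where n: "1 / Suc n < e" using e nat_approx_posE by blast
    obtain z where z: "z \<in> K n" "y \<in> mball z (1 / Suc n)" using K(3)[of n] y by blast
    obtain k where "from_nat_into ?D k = z" using z(1) x by (metis UN_I UNIV_I imageE)
    then show ?thesis using z n by (metis in_mball order_less_trans)
  qed
  moreover have "range (from_nat_into ?D) \<subseteq> mspace X" using x K(2) by blast
  ultimately show ?thesis by blast
qed

text \<open>A substitute for a Whitney map. Strictness comes from a dense point near some
  \<open>b\<close> in \<open>B - A\<close>, which is closer to \<open>B\<close> than to
  \<open>A\<close>. The second property is a one-sided Lipschitz estimate; combined with the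
  approximation of limits of chains it does the work of continuity.\<close>

lemma strictly_monotone_size_function:
  fixes X :: "'a metric"
  assumes X: "continuum X"
  shows "\<exists>\<mu> :: 'a set \<Rightarrow> real.
    (\<forall>A\<in>subcontinua X. \<forall>B\<in>subcontinua X. A \<subset> B \<longrightarrow> \<mu> A < \<mu> B) \<and>
    (\<forall>A\<in>subcontinua X. \<forall>B\<in>subcontinua X. \<forall>\<delta>.
       A \<subseteq> B \<and> (\<forall>b\<in>B. \<exists>a\<in>A. mdist X a b \<le> \<delta>) \<longrightarrow> \<mu> B \<le> \<mu> A + \<delta>)"
proof -
  interpret Metric_space "mspace X" "mdist X" by simp
  have comp: "compact_space (mtopology_of X)" "mspace X \<noteq> {}" using X by (auto simp: continuum_def)
  obtain x where x: "range x \<subseteq> mspace X" "\<And>y e. y \<in> mspace X \<Longrightarrow> e > 0 \<Longrightarrow> \<exists>n::nat. mdist X (x n) y < e"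
    using compact_metric_dense_sequence[OF comp] by blast
  have xM: "x n \<in> mspace X" for n using x(1) by blast
  have "compactin mtopology (mspace X)"
    using comp by (simp add: compact_space_def mtopology_of_def)
  then obtain D where D: "\<And>x y. x \<in> mspace X \<Longrightarrow> y \<in> mspace X \<Longrightarrow> mdist X x y \<le> D"
    using compactin_imp_mbounded unfolding mbounded_alt by metis
  define e where "e n A = (INF a\<in>A. mdist X (x n) a)" for n A
  \<comment> \<open>The sign makes larger sets have larger values. The weights sum to 1, whence the
    Lipschitz constant 1.\<close>
  define \<mu> where "\<mu> A = - (\<Sum>n. (1/2)^Suc n * e n A)" for A
  have bdd: "bdd_below (mdist X y ` A)" for y A
    by (auto intro!: bdd_belowI[of _ 0])
  have ne: "A \<noteq> {}" if "A \<in> subcontinua X" for A using that by (simp add: subcontinua_def)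
  have ele: "e n A \<le> mdist X (x n) a" if "a \<in> A" for n a A
    unfolding e_def by (rule cINF_lower[OF bdd that])
  have e0: "0 \<le> e n A" if "A \<in> subcontinua X" for n A
    unfolding e_def by (rule cINF_greatest) (use ne[OF that] in auto)
  have eD: "e n A \<le> D" if "A \<in> subcontinua X" for n A
  proof -
    obtain a where a: "a \<in> A" using ne[OF \<open>A \<in> subcontinua X\<close>] by blast
    then have "a \<in> mspace X" using subcontinua_subset[OF \<open>A \<in> subcontinua X\<close>] by blast
    then show ?thesis using ele[OF a, of n] D[OF xM[of n]] order_trans by blast
  qed
  have sm: "summable (\<lambda>n. (1/2)^Suc n * e n A)" if "A \<in> subcontinua X" for A
  proof (rule summable_comparison_test)
    show "\<exists>N. \<forall>n\<ge>N. norm ((1/2)^Suc n * e n A) \<le> (1/2)^Suc n * D"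
      using e0[OF that] eD[OF that] by (auto simp: abs_mult)
    have "summable (\<lambda>n. (1/2::real)^Suc n)"
      using sums_summable power_half_series by blast
    then show "summable (\<lambda>n. (1/2)^Suc n * D)" by (rule summable_mult2)
  qed
  have mono: "e n B \<le> e n A" if "A \<in> subcontinua X" "A \<subseteq> B" for A B n
    unfolding e_def by (rule cINF_superset_mono) (use that ne bdd in auto)
  have diff: "\<mu> B - \<mu> A = (\<Sum>n. (1/2)^Suc n * (e n A - e n B))"
    if "A \<in> subcontinua X" "B \<in> subcontinua X" for A B
    unfolding \<mu>_def using suminf_diff[OF sm[OF that(1)] sm[OF that(2)]] by (simp add: right_diff_distrib)
  have sd: "summable (\<lambda>n. (1/2)^Suc n * (e n A - e n B))"
    if "A \<in> subcontinua X" "B \<in> subcontinua X" for A B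
    using summable_diff[OF sm[OF that(1)] sm[OF that(2)]] by (simp add: right_diff_distrib)
  have "\<mu> A < \<mu> B" if A: "A \<in> subcontinua X" and B: "B \<in> subcontinua X" and "A \<subset> B" for A B
  proof -
    obtain b where b: "b \<in> B" "b \<notin> A" using \<open>A \<subset> B\<close> by blast
    have bM: "b \<in> mspace X" using subcontinua_subset[OF B] b by blast
    have "closedin mtopology A" using A by (simp add: subcontinua_def mtopology_of_def)
    then obtain r where r: "r > 0" "disjnt A (mball b r)"
      using b bM unfolding closedin_metric by blast
    \<comment> \<open>The ball of radius \<open>r\<close> about \<open>b\<close> misses
      \<open>A\<close>, so a dense point within \<open>r/2\<close> of \<open>b\<close> stays at
      distance at least \<open>r/2\<close> from \<open>A\<close>.\<close>
    obtain n where n: "mdist X (x n) b < r/2" using x(2)[OF bM, of "r/2"] r by auto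
    have "r/2 \<le> e n A" unfolding e_def
    proof (rule cINF_greatest[OF ne[OF A]])
      fix a assume a: "a \<in> A"
      then have aM: "a \<in> mspace X" using subcontinua_subset[OF A] by blast
      have "a \<notin> mball b r" using r a by (auto simp: disjnt_def)
      then have "r \<le> mdist X b a" using aM bM by auto
      also have "\<dots> \<le> mdist X b (x n) + mdist X (x n) a" using triangle[OF bM xM aM] .
      finally show "r/2 \<le> mdist X (x n) a" using n commute[of b "x n"] by linarith
    qed
    then have "e n B < e n A" using ele[OF b(1), of n] n by linarith
    then have "0 < (\<Sum>n. (1/2)^Suc n * (e n A - e n B))"
      using mono[OF A, of B] \<open>A \<subset> B\<close> by (intro suminf_pos2[OF sd[OF A B], of n]) auto
    then show ?thesis using diff[OF A B] by linarith
  qed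
  moreover have "\<mu> B \<le> \<mu> A + \<delta>"
    if A: "A \<in> subcontinua X" and B: "B \<in> subcontinua X" and AB: "A \<subseteq> B"
      and \<delta>: "\<forall>b\<in>B. \<exists>a\<in>A. mdist X a b \<le> \<delta>" for A B \<delta>
  proof -
    have "e n A - \<delta> \<le> e n B" for n
      unfolding e_def[of n B]
    proof (rule cINF_greatest[OF ne[OF B]])
      fix b assume b: "b \<in> B"
      then obtain a where a: "a \<in> A" "mdist X a b \<le> \<delta>" using \<delta> by blast
      have "a \<in> mspace X" "b \<in> mspace X" using a b A B subcontinua_subset by blast+
      then have "mdist X (x n) a \<le> mdist X (x n) b + mdist X a b" using triangle'[OF xM] by blast
      then show "e n A - \<delta> \<le> mdist X (x n) b" using a ele[OF a(1), of n] by linarith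
    qed
    then have le: "(1/2)^Suc n * (e n A - e n B) \<le> (1/2)^Suc n * \<delta>" for n
      by (intro mult_left_mono) (auto simp: algebra_simps)
    have s: "(\<lambda>n. (1/2)^Suc n * \<delta>) sums \<delta>"
      using sums_mult2[OF power_half_series, of \<delta>] by simp
    have "(\<Sum>n. (1/2)^Suc n * (e n A - e n B)) \<le> (\<Sum>n. (1/2)^Suc n * \<delta>)"
      by (rule suminf_le[OF le sd[OF A B] sums_summable[OF s]])
    then show ?thesis using diff[OF A B] sums_unique[OF s] by linarith
  qed
  ultimately show ?thesis
    by (intro exI[of _ \<mu>] conjI ballI allI impI; (elim conjE)?) metis+
qed

lemma hausdorff_dist_self:
  assumes "continuum X" "A \<in> subcontinua X"
  shows "hausdorff_dist X A A = 0"
  using assms Metric_space.zero[OF Metric_space_hausdorff_dist] unfolding continuum_def by blast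

text \<open>
  A chain of subcontinua that is closed under limits and has no gaps is order isomorphic to
  \<open>{0..1}\<close> by the size function, and monotonicity makes the inverse continuous.
\<close>

lemma gapless_chain_parametrization:
  fixes X :: "'a metric"
  assumes X: "continuum X" and sub: "\<C> \<subseteq> subcontinua X" and ch: "chain_of_sets \<C>"
    and Int: "\<And>\<D>. \<D> \<subseteq> \<C> \<Longrightarrow> \<D> \<noteq> {} \<Longrightarrow> \<Inter>\<D> \<in> \<C>"
    and Un: "\<And>\<D>. \<D> \<subseteq> \<C> \<Longrightarrow> \<D> \<noteq> {} \<Longrightarrow> mtopology_of X closure_of \<Union>\<D> \<in> \<C>"
    and gap: "\<And>A B. A \<in> \<C> \<Longrightarrow> B \<in> \<C> \<Longrightarrow> A \<subset> B \<Longrightarrow> \<exists>Z\<in>\<C>. A \<subset> Z \<and> Z \<subset> B"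
    and two: "A0 \<in> \<C>" "B0 \<in> \<C>" "A0 \<noteq> B0"
  obtains f :: "real \<Rightarrow> 'a set" where "f ` {0..1} = \<C>"
    "\<And>s t. 0 \<le> s \<Longrightarrow> s < t \<Longrightarrow> t \<le> 1 \<Longrightarrow> f s \<subset> f t"
    "\<And>t e. t \<in> {0..1} \<Longrightarrow> e > 0 \<Longrightarrow>
       \<exists>d>0. \<forall>s\<in>{0..1}. \<bar>s - t\<bar> < d \<longrightarrow> hausdorff_dist X (f s) (f t) \<le> e"
proof -
  let ?T = "mtopology_of X"
  obtain \<mu> :: "'a set \<Rightarrow> real" where
    \<mu>: "\<forall>A\<in>subcontinua X. \<forall>B\<in>subcontinua X. A \<subset> B \<longrightarrow> \<mu> A < \<mu> B"
      "\<forall>A\<in>subcontinua X. \<forall>B\<in>subcontinua X. \<forall>\<delta>.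
         A \<subseteq> B \<and> (\<forall>b\<in>B. \<exists>a\<in>A. mdist X a b \<le> \<delta>) \<longrightarrow> \<mu> B \<le> \<mu> A + \<delta>"
    using strictly_monotone_size_function[OF X] by auto
  have \<mu>_less: "\<mu> A < \<mu> B" if "A \<in> \<C>" "B \<in> \<C>" "A \<subset> B" for A B
    using \<mu>(1) sub that by blast
  have \<mu>_le: "\<mu> B \<le> \<mu> A + \<delta>"
    if "A \<in> \<C>" "B \<in> \<C>" "A \<subseteq> B" "\<And>b. b \<in> B \<Longrightarrow> \<exists>a\<in>A. mdist X a b \<le> \<delta>" for A B \<delta>
    using \<mu>(2)[rule_format, of A B \<delta>] sub that by auto
  have subs_iff: "A \<subseteq> B \<longleftrightarrow> \<mu> A \<le> \<mu> B" if "A \<in> \<C>" "B \<in> \<C>" for A B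
  proof -
    have "A = B \<or> A \<subset> B \<or> B \<subset> A" using ch that by (auto simp: chain_of_sets_def)
    then show ?thesis using \<mu>_less[OF that] \<mu>_less[OF that(2,1)]
      by (metis less_imp_le order.refl psubset_imp_subset not_le psubset_eq)
  qed
  have inj: "A = B" if "A \<in> \<C>" "B \<in> \<C>" "\<mu> A = \<mu> B" for A B
    using subs_iff[of A B] subs_iff[of B A] that by auto
  have chD: "chain_of_sets \<D>" if "\<D> \<subseteq> \<C>" for \<D>
    using ch that unfolding chain_of_sets_def by blast
  have UnD: "\<Union>\<D> \<subseteq> ?T closure_of \<Union>\<D>" if "\<D> \<subseteq> \<C>" for \<D>
  proof -
    have "\<Union>\<D> \<subseteq> mspace X" using that sub subcontinua_subset by blast
    then show ?thesis by (simp add: closure_of_subset)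
  qed
  have Un_approx: "\<exists>D\<in>\<D>. \<forall>x\<in>?T closure_of \<Union>\<D>. \<exists>d\<in>D. mdist X d x < e"
    if "\<D> \<subseteq> \<C>" "\<D> \<noteq> {}" "e > 0" for \<D> e
    using that sub by (intro closure_Union_chain_approx[OF X _ _ chD]) auto
  have Int_approx: "\<exists>D\<in>\<D>. \<forall>d\<in>D. \<exists>x\<in>\<Inter>\<D>. mdist X x d < e"
    if "\<D> \<subseteq> \<C>" "\<D> \<noteq> {}" "e > 0" for \<D> e
    using that sub by (intro Inter_chain_approx[OF X _ _ chD]) auto
  define a where "a = \<mu> (\<Inter>\<C>)"
  define b where "b = \<mu> (?T closure_of \<Union>\<C>)"
  have ne: "\<C> \<noteq> {}" using two by blast
  have lowC: "a \<le> \<mu> A" and upC: "\<mu> A \<le> b" if "A \<in> \<C>" for A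
  proof -
    have "\<Inter>\<C> \<subseteq> A" "A \<subseteq> ?T closure_of \<Union>\<C>" using that UnD[of \<C>] by auto
    then show "a \<le> \<mu> A" "\<mu> A \<le> b"
      using subs_iff[OF Int[of \<C>] that] subs_iff[OF that Un[of \<C>]] ne unfolding a_def b_def by auto
  qed
  have "\<mu> A0 \<noteq> \<mu> B0" using two inj by blast
  then have ab: "a < b"
    using lowC[OF two(1)] lowC[OF two(2)] upC[OF two(1)] upC[OF two(2)] by linarith
  have onto: "\<exists>A\<in>\<C>. \<mu> A = t" if t: "t \<in> {a..b}" for t
  proof -
    \<comment> \<open>A cut at \<open>t\<close>: the limits from below and from above belong to the
      chain, and their sizes enclose \<open>t\<close>. If they differed, a member strictly between
      them would belong to one of the two halves, which is impossible.\<close>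
    let ?D = "{A\<in>\<C>. \<mu> A \<le> t}" and ?E = "{A\<in>\<C>. t \<le> \<mu> A}"
    have D: "?D \<noteq> {}" using t Int[of \<C>] ne unfolding a_def by auto
    have E: "?E \<noteq> {}" using t Un[of \<C>] ne unfolding b_def by auto
    let ?U = "?T closure_of \<Union>?D" and ?I = "\<Inter>?E"
    have U: "?U \<in> \<C>" and I: "?I \<in> \<C>" using Un[OF _ D] Int[OF _ E] by auto
    \<comment> \<open>Some member of the lower half is \<open>e\<close>-dense in the limit, so the
      limit exceeds \<open>t\<close> by at most \<open>e\<close>.\<close>
    have Ut: "\<mu> ?U \<le> t"
    proof (rule field_le_epsilon)
      fix e :: real assume "e > 0"
      then obtain A where A: "A \<in> ?D" "\<forall>x\<in>?U. \<exists>d\<in>A. mdist X d x < e" using Un_approx[OF _ D] by blast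
      have "\<mu> ?U \<le> \<mu> A + e"
      proof (rule \<mu>_le)
        show "A \<subseteq> ?U" using A UnD[of ?D] by blast
      qed (use A U less_imp_le in blast)+
      then show "\<mu> ?U \<le> t + e" using A by auto
    qed
    have It: "t \<le> \<mu> ?I"
    proof (rule field_le_epsilon)
      fix e :: real assume "e > 0"
      then obtain A where A: "A \<in> ?E" "\<forall>d\<in>A. \<exists>x\<in>?I. mdist X x d < e" using Int_approx[OF _ E] by blast
      have "\<mu> A \<le> \<mu> ?I + e"
      proof (rule \<mu>_le)
        show "?I \<subseteq> A" using A by blast
      qed (use A I less_imp_le in blast)+
      then show "t \<le> \<mu> ?I + e" using A by auto
    qed
    have "?U = ?I"
    proof (rule ccontr)
      assume "?U \<noteq> ?I"
      moreover have "?U \<subseteq> ?I" using subs_iff[OF U I] Ut It by linarith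
      ultimately obtain Z where Z: "Z \<in> \<C>" "?U \<subset> Z" "Z \<subset> ?I" using gap[OF U I] by blast
      have "Z \<subseteq> ?U \<or> ?I \<subseteq> Z"
      proof (cases "\<mu> Z \<le> t")
        case True
        then show ?thesis using Z UnD[of ?D] by blast
      next
        case False
        then have "Z \<in> ?E" using Z by simp
        then show ?thesis by blast
      qed
      then show False using Z by blast
    qed
    then have "\<mu> ?U = t" using Ut It by simp
    then show ?thesis using U by blast
  qed
  \<comment> \<open>Affine rescaling of the sizes from \<open>{a..b}\<close> to
    \<open>{0..1}\<close>.\<close>
  define f where "f s = (THE A. A \<in> \<C> \<and> \<mu> A = a + s * (b - a))" for s
  have f: "f s \<in> \<C>" "\<mu> (f s) = a + s * (b - a)" if "s \<in> {0..1}" for s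
  proof -
    have "0 \<le> s * (b - a)" "s * (b - a) \<le> 1 * (b - a)"
      using that ab by (intro mult_nonneg_nonneg mult_right_mono; simp)+
    then obtain A where "A \<in> \<C>" "\<mu> A = a + s * (b - a)" using onto[of "a + s * (b - a)"] by auto
    then have "\<exists>!A. A \<in> \<C> \<and> \<mu> A = a + s * (b - a)" using inj by metis
    from theI'[OF this] show "f s \<in> \<C>" "\<mu> (f s) = a + s * (b - a)" unfolding f_def by auto
  qed
  have f_sub: "f s \<subseteq> f t \<longleftrightarrow> s \<le> t" if "s \<in> {0..1}" "t \<in> {0..1}" for s t
    using subs_iff[OF f(1)[OF that(1)] f(1)[OF that(2)]] f(2)[OF that(1)] f(2)[OF that(2)] ab by simp
  have f_onto: "\<exists>s\<in>{0..1}. A = f s" if "A \<in> \<C>" for A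
  proof -
    let ?s = "(\<mu> A - a) / (b - a)"
    have s: "?s \<in> {0..1}" using ab lowC[OF that] upC[OF that] by (auto simp: field_simps)
    have "\<mu> (f ?s) = \<mu> A" using f(2)[OF s] ab by simp
    then show ?thesis using inj[OF that f(1)[OF s]] s by metis
  qed
  have fsc: "f s \<in> subcontinua X" if "s \<in> {0..1}" for s using f(1)[OF that] sub by blast
  interpret Metric_space "mspace X" "mdist X" by simp
  \<comment> \<open>A squeeze: sets between \<open>f r\<close> and \<open>f u\<close> are mutually
    \<open>e\<close>-close as soon as \<open>f u\<close> lies in the \<open>e\<close>-neighbourhood
    of \<open>f r\<close>.\<close>
  have close: "hausdorff_dist X (f s) (f t) \<le> e \<and> hausdorff_dist X (f t) (f s) \<le> e"
    if st: "r \<in> {0..1}" "u \<in> {0..1}" "r \<le> s" "s \<le> u" "r \<le> t" "t \<le> u"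
      and ap: "\<forall>x\<in>f u. \<exists>d\<in>f r. mdist X d x < e" for r u s t e
  proof -
    have st': "s \<in> {0..1}" "t \<in> {0..1}" using st by auto
    have *: "\<exists>y\<in>f t. mdist X x y \<le> e" if "x \<in> f s" "s \<in> {0..1}" "t \<in> {0..1}" "r \<le> t" "s \<le> u" for x s t
    proof -
      have "x \<in> f u" using that f_sub[of s u] st by blast
      then obtain d where "d \<in> f r" "mdist X d x < e" using ap by blast
      then show ?thesis using f_sub[of r t] st that commute[of d x] by (metis less_imp_le subsetD)
    qed
    have "hausdorff_dist X (f s) (f t) \<le> e"
    proof (rule hausdorff_dist_leI[OF fsc[OF st'(1)] fsc[OF st'(2)]])
      show "\<exists>b\<in>f t. mdist X a b \<le> e" if "a \<in> f s" for a using *[OF that st'] st by simp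
      show "\<exists>a\<in>f s. mdist X a b \<le> e" if "b \<in> f t" for b
        using *[OF that st'(2,1)] st commute by metis
    qed
    then show ?thesis using hausdorff_dist_commute[OF X] by metis
  qed
  have left: "\<exists>d>0. \<forall>s\<in>{0..1}. t - d < s \<and> s \<le> t \<longrightarrow> hausdorff_dist X (f s) (f t) \<le> e"
    if t: "t \<in> {0..1}" and e: "e > 0" for t e
  proof (cases "t = 0")
    case True
    have "hausdorff_dist X (f 0) (f 0) \<le> e"
      using e hausdorff_dist_self[OF X fsc[of 0]] by simp
    then show ?thesis using True by (intro exI[of _ 1]) auto
  next
    case False
    let ?D = "f ` {0..<t}"
    have D: "?D \<subseteq> \<C>" "?D \<noteq> {}" using f(1) t False by auto
    obtain t' where t': "t' \<in> {0..1}" "?T closure_of \<Union>?D = f t'" using f_onto[OF Un[OF D]] by blast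
    have "s \<le> t'" if "s \<in> {0..<t}" for s
    proof -
      have "f s \<subseteq> f t'" using UnD[OF D(1)] t'(2) that by blast
      then show ?thesis using f_sub[of s t'] t t' that by auto
    qed
    \<comment> \<open>If \<open>t'\<close> were below \<open>t\<close>, the midpoint would be a
      parameter below \<open>t\<close> and yet above \<open>t'\<close>.\<close>
    from this[of "(t' + t) / 2"] have "t \<le> t'" using t t' by fastforce
    then have sub_t: "f t \<subseteq> ?T closure_of \<Union>?D" using f_sub[OF t t'(1)] t' by simp
    obtain r where r: "r \<in> {0..<t}" "\<forall>x\<in>?T closure_of \<Union>?D. \<exists>d\<in>f r. mdist X d x < e"
      using Un_approx[OF D e] by blast
    have "hausdorff_dist X (f s) (f t) \<le> e" if "s \<in> {0..1}" "t - (t - r) < s" "s \<le> t" for s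
      using close[of r t s t e] r t that sub_t by auto
    then show ?thesis using r by (intro exI[of _ "t - r"]) auto
  qed
  have right: "\<exists>d>0. \<forall>s\<in>{0..1}. t \<le> s \<and> s < t + d \<longrightarrow> hausdorff_dist X (f s) (f t) \<le> e"
    if t: "t \<in> {0..1}" and e: "e > 0" for t e
  proof (cases "t = 1")
    case True
    obtain d where "d>0" "\<forall>s\<in>{0..1}. t - d < s \<and> s \<le> t \<longrightarrow> hausdorff_dist X (f s) (f t) \<le> e"
      using left[OF t e] by blast
    then have "hausdorff_dist X (f 1) (f 1) \<le> e" using True by auto
    then show ?thesis using True by (intro exI[of _ 1]) (auto dest: antisym)
  next
    case False
    let ?D = "f ` {t<..1}"
    have D: "?D \<subseteq> \<C>" "?D \<noteq> {}" using f(1) t False by auto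
    obtain t' where t': "t' \<in> {0..1}" "\<Inter>?D = f t'" using f_onto[OF Int[OF D]] by blast
    have "t' \<le> s" if "s \<in> {t<..1}" for s
    proof -
      have "f t' \<subseteq> f s" using t'(2) that by blast
      then show ?thesis using f_sub[of t' s] t t' that by auto
    qed
    from this[of "(t' + t) / 2"] have "t' \<le> t" using t t' by fastforce
    then have sub_t: "\<Inter>?D \<subseteq> f t" using f_sub[OF t'(1) t] t' by simp
    obtain u where u: "u \<in> {t<..1}" "\<forall>d\<in>f u. \<exists>x\<in>\<Inter>?D. mdist X x d < e"
      using Int_approx[OF D e] by blast
    have "\<forall>d\<in>f u. \<exists>x\<in>f t. mdist X x d < e" using u(2) sub_t by blast
    then have "hausdorff_dist X (f s) (f t) \<le> e" if "s \<in> {0..1}" "t \<le> s" "s < t + (u - t)" for s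
      using close[of t u s t e] u t that by auto
    then show ?thesis using u by (intro exI[of _ "u - t"]) auto
  qed
  show thesis
  proof
    show "f ` {0..1} = \<C>" using f(1) f_onto by blast
    show "f s \<subset> f t" if "0 \<le> s" "s < t" "t \<le> 1" for s t
      using f_sub[of s t] f_sub[of t s] that by auto
    show "\<exists>d>0. \<forall>s\<in>{0..1}. \<bar>s - t\<bar> < d \<longrightarrow> hausdorff_dist X (f s) (f t) \<le> e"
      if "t \<in> {0..1}" "e > 0" for t e
    proof -
      obtain d1 d2 where "d1 > 0" "d2 > 0"
        "\<forall>s\<in>{0..1}. t - d1 < s \<and> s \<le> t \<longrightarrow> hausdorff_dist X (f s) (f t) \<le> e"
        "\<forall>s\<in>{0..1}. t \<le> s \<and> s < t + d2 \<longrightarrow> hausdorff_dist X (f s) (f t) \<le> e"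
        using left[OF \<open>t \<in> {0..1}\<close> \<open>e > 0\<close>] right[OF \<open>t \<in> {0..1}\<close> \<open>e > 0\<close>] by blast
      then show ?thesis by (intro exI[of _ "min d1 d2"]) (auto simp: abs_if split: if_splits)
    qed
  qed
qed

section \<open>Hyperspaces that are arcs, and the hyperspaces of the interval\<close>

lemma mtopology_of_hyperspace_at:
  "mtopology_of (hyperspace_at p X) = Metric_space.mtopology (subcontinua_at p X) (hausdorff_dist X)"
  if "continuum X"
  using that by (simp add: mtopology_of_def)

lemma continuous_map_hyperspaceI:
  fixes S :: "'m::metric_space set"
  assumes X: "continuum X" and f: "f ` S \<subseteq> subcontinua_at p X"
    and cont: "\<And>x e. x \<in> S \<Longrightarrow> e > 0 \<Longrightarrow>
       \<exists>d>0. \<forall>y\<in>S. dist y x < d \<longrightarrow> hausdorff_dist X (f y) (f x) \<le> e"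
  shows "continuous_map (top_of_set S) (mtopology_of (hyperspace_at p X)) f"
proof -
  interpret H: Metric_space "subcontinua_at p X" "hausdorff_dist X"
    by (rule Metric_space_hyperspace_at[OF X])
  have "\<exists>U. openin (top_of_set S) U \<and> x \<in> U \<and> (\<forall>y\<in>U. f y \<in> H.mball (f x) e)"
    if x: "x \<in> S" and e: "e > 0" for x e
  proof -
    \<comment> \<open>Half of \<open>e\<close>, because the assumption gives a weak inequality and
      the ball is open.\<close>
    obtain d where d: "d > 0" "\<forall>y\<in>S. dist y x < d \<longrightarrow> hausdorff_dist X (f y) (f x) \<le> e/2"
      using cont[OF x, of "e/2"] e by auto
    have "f y \<in> H.mball (f x) e" if "y \<in> S \<inter> ball x d" for y
    proof -
      have "hausdorff_dist X (f y) (f x) \<le> e/2" using d(2) that by (auto simp: dist_commute)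
      then show ?thesis using e f x that H.commute[of "f x" "f y"] by auto
    qed
    moreover have "openin (top_of_set S) (S \<inter> ball x d)" by (simp add: openin_open_Int)
    ultimately show ?thesis using x d(1) by (intro exI[of _ "S \<inter> ball x d"]) auto
  qed
  then show ?thesis
    unfolding mtopology_of_hyperspace_at[OF X] H.continuous_map_to_metric by simp
qed

lemma subcontinua_atD: "A \<in> subcontinua_at p X \<Longrightarrow> A \<in> subcontinua X" "A \<in> subcontinua_at p X \<Longrightarrow> p \<in> A"
  by (auto simp: subcontinua_at_def)

lemma homeomorphic_hyperspace_chain:
  fixes X :: "'a metric"
  assumes X: "continuum X" and nd: "\<not> degenerate (mspace X)" and p: "p \<in> mspace X"
    and ch: "chain_of_sets (subcontinua_at p X)"
  shows "mtopology_of (hyperspace_at p X) homeomorphic_space top_of_set {0..1::real}"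
proof -
  let ?C = "subcontinua_at p X"
  have chD: "chain_of_sets \<D>" if "\<D> \<subseteq> ?C" for \<D>
    using ch that unfolding chain_of_sets_def by blast
  have subD: "\<D> \<subseteq> subcontinua X" if "\<D> \<subseteq> ?C" for \<D>
    using that by (auto simp: subcontinua_at_def)
  obtain f :: "real \<Rightarrow> 'a set" where f: "f ` {0..1} = ?C"
    "\<And>s t. 0 \<le> s \<Longrightarrow> s < t \<Longrightarrow> t \<le> 1 \<Longrightarrow> f s \<subset> f t"
    "\<And>t e. t \<in> {0..1} \<Longrightarrow> e > 0 \<Longrightarrow>
       \<exists>d>0. \<forall>s\<in>{0..1}. \<bar>s - t\<bar> < d \<longrightarrow> hausdorff_dist X (f s) (f t) \<le> e"
  proof (rule gapless_chain_parametrization[OF X subD[OF order_refl] ch])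
    show "\<Inter>\<D> \<in> ?C" if "\<D> \<subseteq> ?C" "\<D> \<noteq> {}" for \<D>
    proof -
      have "p \<in> \<Inter>\<D>" using that(1) by (auto simp: subcontinua_at_def)
      then show ?thesis
        using subcontinuum_Inter_chain[OF X subD[OF that(1)] that(2) chD[OF that(1)]]
        by (simp add: subcontinua_at_def)
    qed
    show "mtopology_of X closure_of \<Union>\<D> \<in> ?C" if "\<D> \<subseteq> ?C" "\<D> \<noteq> {}" for \<D>
    proof -
      have "\<Union>\<D> \<subseteq> topspace (mtopology_of X)"
        using subD[OF that(1)] subcontinua_subset[of _ X] unfolding topspace_mtopology_of by blast
      moreover have "p \<in> \<Union>\<D>" using that by (auto simp: subcontinua_at_def)
      ultimately have "p \<in> mtopology_of X closure_of \<Union>\<D>"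
        using closure_of_subset by (metis subsetD)
      then show ?thesis
        using subcontinuum_closure_Union_chain[OF subD[OF that(1)] that(2) chD[OF that(1)]]
        by (simp add: subcontinua_at_def)
    qed
    show "\<exists>Z\<in>?C. A \<subset> Z \<and> Z \<subset> B" if "A \<in> ?C" "B \<in> ?C" "A \<subset> B" for A B
    proof -
      obtain Z where "Z \<in> subcontinua X" "A \<subset> Z" "Z \<subset> B"
        using intermediate_subcontinuum[OF X subcontinua_atD(1)[OF \<open>A \<in> ?C\<close>] subcontinua_atD(1)[OF \<open>B \<in> ?C\<close>] \<open>A \<subset> B\<close>]
        by blast
      then show ?thesis using subcontinua_atD(2)[OF \<open>A \<in> ?C\<close>] by (auto simp: subcontinua_at_def)
    qed
    show "{p} \<in> ?C" "mspace X \<in> ?C"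
      using p X by (simp_all add: subcontinua_at_def subcontinuum_singleton subcontinuum_mspace)
    show "{p} \<noteq> mspace X" using nd by (auto simp: degenerate_def)
  qed (rule that)
  let ?H = "mtopology_of (hyperspace_at p X)"
  have "continuous_map (top_of_set {0..1}) ?H f"
    by (rule continuous_map_hyperspaceI[OF X]) (use f in \<open>auto simp: dist_real_def\<close>)
  moreover have "inj_on f {0..1}"
    by (rule linorder_inj_onI) (use f(2) in \<open>auto simp: psubset_eq\<close>)
  ultimately have "homeomorphic_map (top_of_set {0..1}) ?H f"
    using f(1) X by (intro continuous_imp_homeomorphic_map) (auto simp: Hausdorff_mtopology_of compact_space_subtopology)
  then show ?thesis
    using homeomorphic_map_imp_homeomorphic_space homeomorphic_space_sym by blast
qed

section \<open>Hyperspaces of the unit interval\<close>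

definition unit_interval :: "real metric" where
  "unit_interval = submetric euclidean_metric {0..1}"

lemma mspace_unit_interval [simp]: "mspace unit_interval = {0..1}"
  and mdist_unit_interval [simp]: "mdist unit_interval = dist"
  and mtopology_of_unit_interval [simp]: "mtopology_of unit_interval = top_of_set {0..1}"
  by (simp_all add: unit_interval_def mtopology_of_submetric)

lemma continuum_unit_interval: "continuum unit_interval"
  by (simp add: continuum_def compact_space_subtopology connected_space_subtopology)

lemma subcontinua_unit_interval:
  "subcontinua unit_interval = {{a..b} | a b. 0 \<le> a \<and> a \<le> b \<and> b \<le> 1}"
proof -
  have "A \<in> subcontinua unit_interval \<longleftrightarrow> A \<noteq> {} \<and> A \<subseteq> {0..1} \<and> (\<exists>a b. A = {a..b})" for A
  proof -
    have "closedin (top_of_set {0..1}) A \<and> connected A \<longleftrightarrow> A \<subseteq> {0..1} \<and> connected A \<and> compact A"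
      by (metis closed_real_atLeastAtMost closedin_closed_eq compact_Icc compact_eq_bounded_closed bounded_subset)
    then show ?thesis
      unfolding connected_compact_interval_1[symmetric]
      by (auto simp: subcontinua_def connectedin_subtopology)
  qed
  moreover have "A \<noteq> {} \<and> A \<subseteq> {0..1} \<and> (\<exists>a b. A = {a..b}) \<longleftrightarrow>
      (\<exists>a b. A = {a..b} \<and> 0 \<le> a \<and> a \<le> b \<and> b \<le> 1)" for A :: "real set"
  proof -
    have "{a..b} \<noteq> {} \<and> {a..b} \<subseteq> {0..1} \<longleftrightarrow> 0 \<le> a \<and> a \<le> b \<and> b \<le> 1" for a b :: real
      by auto
    then show ?thesis by metis
  qed
  ultimately show ?thesis
    by (intro set_eqI) (simp only: mem_Collect_eq)
qed

text \<open>A closed interval around \<open>q\<close> is recorded by its two ends, which vary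
  independently in \<open>{0..q}\<close> and \<open>{q..1}\<close>. The rectangle is an arc for
  \<open>q = 0\<close> and a 2-cell for \<open>0 < q < 1\<close>.\<close>

lemma homeomorphic_hyperspace_unit_interval:
  assumes q: "q \<in> {0..1}"
  shows "mtopology_of (hyperspace_at q unit_interval) homeomorphic_space top_of_set ({0..q} \<times> {q..1})"
proof -
  let ?S = "{0..q} \<times> {q..1}" and ?f = "\<lambda>x::real\<times>real. {fst x..snd x}"
  let ?H = "mtopology_of (hyperspace_at q unit_interval)"
  have im: "?f ` ?S = subcontinua_at q unit_interval"
  proof -
    have "A \<in> ?f ` ?S" if A: "A \<in> subcontinua_at q unit_interval" for A
    proof -
      obtain a b where "A = {a..b}" "0 \<le> a" "a \<le> b" "b \<le> 1" "q \<in> A"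
        using A by (auto simp: subcontinua_at_def subcontinua_unit_interval)
      then show ?thesis by (intro image_eqI[of _ _ "(a, b)"]) auto
    qed
    then show ?thesis by (auto simp: subcontinua_at_def subcontinua_unit_interval)
  qed
  have "continuous_map (top_of_set ?S) ?H ?f"
  proof (rule continuous_map_hyperspaceI[OF continuum_unit_interval])
    fix x :: "real \<times> real" and e :: real assume x: "x \<in> ?S" and e: "e > 0"
    have "hausdorff_dist unit_interval (?f y) (?f x) \<le> e" if y: "y \<in> ?S" and d: "dist y x < e" for y
    proof -
      have d': "\<bar>fst y - fst x\<bar> < e" "\<bar>snd y - snd x\<bar> < e"
        using dist_fst_le[of y x] dist_snd_le[of y x] d by (auto simp: dist_real_def)
      have *: "\<exists>t\<in>?f y. dist s t \<le> e \<and> dist t s \<le> e"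
        if "s \<in> ?f x" "\<bar>fst y - fst x\<bar> < e" "\<bar>snd y - snd x\<bar> < e" "x \<in> ?S" "y \<in> ?S" for x y s
        \<comment> \<open>The witness is \<open>s\<close> clamped to \<open>?f y\<close>; as the
          ends of the two intervals differ by less than \<open>e\<close>, clamping moves
          \<open>s\<close> by at most \<open>e\<close>.\<close>
        using that e by (intro bexI[of _ "max (fst y) (min s (snd y))"]) (auto simp: dist_real_def)
      have sub: "?f x \<in> subcontinua unit_interval" "?f y \<in> subcontinua unit_interval"
        using x y by (auto simp: subcontinua_unit_interval)
      show ?thesis
      proof (rule hausdorff_dist_leI[OF sub(2,1)])
        show "\<exists>t\<in>?f x. mdist unit_interval s t \<le> e" if "s \<in> ?f y" for s
          using *[of s y x] that d' x y by (auto simp: abs_minus_commute)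
        show "\<exists>t\<in>?f y. mdist unit_interval t s \<le> e" if "s \<in> ?f x" for s
          using *[of s x y] that d' x y by auto
      qed
    qed
    then show "\<exists>d>0. \<forall>y\<in>?S. dist y x < d \<longrightarrow> hausdorff_dist unit_interval (?f y) (?f x) \<le> e"
      using e by blast
  qed (use im in auto)
  moreover have "inj_on ?f ?S"
    by (auto simp: inj_on_def Icc_eq_Icc)
  ultimately have "homeomorphic_map (top_of_set ?S) ?H ?f"
    using im continuum_unit_interval
    by (intro continuous_imp_homeomorphic_map)
       (auto simp: Hausdorff_mtopology_of compact_space_subtopology compact_Times)
  then show ?thesis
    using homeomorphic_map_imp_homeomorphic_space homeomorphic_space_sym by blast
qed

text \<open>Both spaces are quotients of \<open>S\<close> by the same identification, since a
  continuous surjection from a compact space to a Hausdorff space is closed. This reduces the shape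
  of C(p, X) to a comparison of kernels.\<close>

lemma homeomorphic_space_same_kernel:
  fixes F :: "'m::metric_space \<Rightarrow> 'n::metric_space"
  assumes S: "compact S" and \<Phi>: "continuous_map (top_of_set S) T \<Phi>" "\<Phi> ` S = topspace T"
    and T: "Hausdorff_space T" and F: "continuous_on S F"
    and ker: "\<And>x y. x \<in> S \<Longrightarrow> y \<in> S \<Longrightarrow> \<Phi> x = \<Phi> y \<longleftrightarrow> F x = F y"
  shows "T homeomorphic_space top_of_set (F ` S)"
proof -
  have comp: "compact_space (top_of_set S)" using S by (simp add: compact_space_subtopology)
  have "quotient_map (top_of_set S) T \<Phi>"
    using \<Phi> comp T continuous_imp_closed_map by (intro continuous_closed_imp_quotient_map) auto
  moreover have "continuous_map (top_of_set S) (top_of_set (F ` S)) F"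
    using F by (auto simp: continuous_map_in_subtopology)
  ultimately obtain g where g: "continuous_map T (top_of_set (F ` S)) g" "g ` topspace T = F ` S"
    "\<And>x. x \<in> S \<Longrightarrow> g (\<Phi> x) = F x"
  proof (rule quotient_map_lift_exists[of "top_of_set S" T \<Phi> "top_of_set (F ` S)" F])
    show "F x = F y" if "x \<in> topspace (top_of_set S)" "y \<in> topspace (top_of_set S)" "\<Phi> x = \<Phi> y" for x y
      using that ker[of x y] by simp
  qed auto
  have "compact_space T"
    using image_compactin[OF _ \<Phi>(1), of S] comp \<Phi>(2) by (simp add: compact_space_def)
  moreover have "inj_on g (topspace T)"
    using g(3) ker unfolding \<Phi>(2)[symmetric] inj_on_def by (metis imageE)
  ultimately have "homeomorphic_map T (top_of_set (F ` S)) g"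
    using g by (intro continuous_imp_homeomorphic_map) (auto simp: Hausdorff_space_subtopology)
  then show ?thesis by (rule homeomorphic_map_imp_homeomorphic_space)
qed

text \<open>The preimages of the two halves of \<open>{0..1}\<close> are proper subcontinua that
  cover \<open>X\<close>.\<close>

lemma decomposable_homeomorphic_unit_interval:
  assumes h: "homeomorphic_map (mtopology_of X) (mtopology_of unit_interval) h"
  shows "decomposable X"
proof -
  let ?T = "mtopology_of X" and ?I = "top_of_set {0..1::real}"
  have im: "h ` mspace X = {0..1}" and inj: "inj_on h (mspace X)"
    using homeomorphic_imp_surjective_map[OF h] homeomorphic_imp_injective_map[OF h] by auto
  have sub: "{x \<in> mspace X. h x \<in> {a..b}} \<in> subcontinua X - {mspace X}" (is "?A \<in> _")
    if ab: "0 \<le> a" "a \<le> b" "b \<le> 1" "b < 1 \<or> 0 < a" for a b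
  proof -
    have "{a..b} \<subseteq> h ` mspace X" using im ab by auto
    then have hA: "h ` ?A = {a..b}" by blast
    have "{a..b} \<in> subcontinua unit_interval" using ab by (auto simp: subcontinua_unit_interval)
    then have "closedin ?T ?A" "connectedin ?T ?A"
      using homeomorphic_map_closedness[OF h, of ?A] homeomorphic_map_connectedness[OF h, of ?A] hA
      by (auto simp: subcontinua_def)
    moreover have "?A \<noteq> {}" using hA ab by auto
    moreover have "?A \<noteq> mspace X"
    proof
      assume "?A = mspace X"
      then have "{a..b} = {0..1}" using hA im by simp
      then show False using ab by (auto simp: Icc_eq_Icc)
    qed
    ultimately show ?thesis by (simp add: subcontinua_def)
  qed
  have "mspace X = {x \<in> mspace X. h x \<in> {0..1/2}} \<union> {x \<in> mspace X. h x \<in> {1/2..1}}"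
    using im by force
  moreover have "{x \<in> mspace X. h x \<in> {0..1/2}} \<in> subcontinua X - {mspace X}"
    "{x \<in> mspace X. h x \<in> {1/2..1}} \<in> subcontinua X - {mspace X}"
    by (rule sub; simp)+
  ultimately show ?thesis
    unfolding decomposable_def by blast
qed

section \<open>Comparison with the unit interval, and the case of a chain\<close>

lemma not_unique_hyperspace_atI:
  assumes "indecomposable X" and "q \<in> {0..1::real}"
    and "mtopology_of (hyperspace_at p X) homeomorphic_space top_of_set ({0..q} \<times> {q..1})"
  shows "\<not> unique_hyperspace_at p X"
proof
  assume "unique_hyperspace_at p X"
  moreover have "mtopology_of (hyperspace_at p X) homeomorphic_space mtopology_of (hyperspace_at q unit_interval)"
    using assms(3) homeomorphic_hyperspace_unit_interval[OF assms(2)] homeomorphic_space_sym homeomorphic_space_trans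
    by metis
  moreover have "q \<in> mspace unit_interval" using assms(2) by simp
  ultimately obtain h where "homeomorphic_map (mtopology_of X) (mtopology_of unit_interval) h"
    unfolding unique_hyperspace_at_def using continuum_unit_interval by blast
  then show False using decomposable_homeomorphic_unit_interval assms(1) by blast
qed

lemma not_unique_hyperspace_at_chain:
  assumes "continuum X" "\<not> degenerate (mspace X)" "p \<in> mspace X" "indecomposable X"
    and "chain_of_sets (subcontinua_at p X)"
  shows "\<not> unique_hyperspace_at p X"
\<comment> \<open>For \<open>q = 0\<close> the rectangle is a segment.\<close>
proof (rule not_unique_hyperspace_atI[where q=0])
  have "top_of_set {0..1::real} homeomorphic_space top_of_set ({0..0::real} \<times> {0..1::real})"
    unfolding homeomorphic_space_def homeomorphic_maps_def
    by (rule exI[of _ "Pair 0"], rule exI[of _ snd]) (auto intro!: continuous_intros simp: continuous_map_in_subtopology)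
  then show "mtopology_of (hyperspace_at p X) homeomorphic_space top_of_set ({0..0::real} \<times> {0..1::real})"
    by (rule homeomorphic_space_trans[OF homeomorphic_hyperspace_chain[OF assms(1-3,5)]])
qed (use assms in auto)

text \<open>Two members share \<open>p\<close>, so their union is a continuum, and they decompose it
  unless one of them is the whole union.\<close>

lemma hereditarily_indecomposable_chain:
  assumes hi: "hereditarily_indecomposable X"
  shows "chain_of_sets (subcontinua_at p X)"
  unfolding chain_of_sets_def
proof (intro ballI)
  fix A B assume AB: "A \<in> subcontinua_at p X" "B \<in> subcontinua_at p X"
  let ?C = "A \<union> B"
  have C: "?C \<in> subcontinua X"
    using AB by (intro subcontinuum_Un) (auto simp: subcontinua_at_def)
  have [simp]: "?C \<inter> mspace X = ?C" using subcontinua_subset[OF C] by blast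
  have "D \<in> subcontinua (submetric X ?C)" if "D \<in> subcontinua X" "D \<subseteq> ?C" for D
    using that by (auto simp: subcontinua_def mtopology_of_submetric connectedin_subtopology intro: closedin_subset_topspace)
  from this[of A] this[of B] have "A \<in> subcontinua (submetric X ?C)" "B \<in> subcontinua (submetric X ?C)"
    using AB by (simp_all add: subcontinua_at_def)
  moreover have "indecomposable (submetric X ?C)"
    using hi C by (simp add: hereditarily_indecomposable_def)
  ultimately have "A = ?C \<or> B = ?C" unfolding decomposable_def mspace_submetric \<open>?C \<inter> mspace X = ?C\<close> by blast
  then show "A \<subseteq> B \<or> B \<subseteq> A" by blast
qed

lemma hereditarily_indecomposable_imp_indecomposable:
  assumes "continuum X" "hereditarily_indecomposable X"
  shows "indecomposable X"
proof -
  have "submetric X (mspace X) = X"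
    by (simp add: submetric_def metric_collapse)
  then show ?thesis
    using assms subcontinuum_mspace unfolding hereditarily_indecomposable_def by metis
qed

section \<open>Two planar models of the 2-cell\<close>

text \<open>Planar convex bodies are all homeomorphic. For this reason the models below collapse
  sides of the square by formulas with convex images.\<close>

lemma homeomorphic_square:
  fixes S :: "(real \<times> real) set"
  assumes "convex S" "compact S" "interior S \<noteq> {}"
  shows "top_of_set S homeomorphic_space top_of_set ({0..1/2::real} \<times> {1/2..1::real})"
proof -
  have "interior ({0..1/2::real} \<times> {1/2..1::real}) \<noteq> {}"
    by (simp add: interior_Times)
  then have "S homeomorphic {0..1/2::real} \<times> {1/2..1::real}"
    using assms by (intro homeomorphic_convex_compact) (auto simp: convex_Times compact_Times)
  then obtain f g where "homeomorphism S ({0..1/2::real} \<times> {1/2..1::real}) f g"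
    unfolding homeomorphic_def by blast
  then have "homeomorphic_maps (top_of_set S) (top_of_set ({0..1/2::real} \<times> {1/2..1::real})) f g"
    by (auto simp: homeomorphism_def homeomorphic_maps_def continuous_map_in_subtopology)
  then show ?thesis
    unfolding homeomorphic_space_def by blast
qed

text \<open>The lens is the square with the sides \<open>s = 1\<close> and \<open>t = 1\<close> collapsed to one point.\<close>

lemma lens_model:
  defines "F \<equiv> \<lambda>(s, t). ((1 - max s t) * (s - t), max s t :: real)"
  shows "continuous_on ({0..1} \<times> {0..1}) F"
    and "top_of_set (F ` ({0..1} \<times> {0..1})) homeomorphic_space top_of_set ({0..1/2::real} \<times> {1/2..1::real})"
proof -
  show cont: "continuous_on ({0..1} \<times> {0..1}) F"
    unfolding F_def case_prod_beta by (intro continuous_intros)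
  \<comment> \<open>At level \<open>y = max s t\<close> the difference \<open>s - t\<close> ranges
    from \<open>-y\<close> to \<open>y\<close>. The factor \<open>1 - y\<close> contracts the top
    level to a point, which leaves the region between two parabolas.\<close>
  let ?L = "{(x, y). 0 \<le> y \<and> y \<le> 1 \<and> \<bar>x\<bar> \<le> y * (1 - y)} :: (real \<times> real) set"
  have im: "F ` ({0..1} \<times> {0..1}) = ?L"
  proof (intro equalityI subsetI)
    fix z assume "z \<in> F ` ({0..1} \<times> {0..1})"
    then obtain s t where st: "0 \<le> s" "s \<le> 1" "0 \<le> t" "t \<le> 1" "z = F (s, t)" by auto
    let ?m = "max s t"
    have "\<bar>(1 - ?m) * (s - t)\<bar> = (1 - ?m) * \<bar>s - t\<bar>" using st by (simp add: abs_mult)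
    also have "\<dots> \<le> (1 - ?m) * ?m" using st by (intro mult_left_mono) auto
    finally show "z \<in> ?L" using st by (auto simp: F_def mult.commute)
  next
    fix z assume "z \<in> ?L"
    then obtain x y where z: "z = (x, y)" "0 \<le> y" "y \<le> 1" "\<bar>x\<bar> \<le> y * (1 - y)" by blast
    show "z \<in> F ` ({0..1} \<times> {0..1})"
    proof (cases "y = 1")
      case True
      then have "z = F (1, 1)" using z by (simp add: F_def)
      then show ?thesis by auto
    next
      case False
      then have y: "y < 1" using z by simp
      \<comment> \<open>\<open>d\<close> recovers \<open>s - t\<close>: its sign tells which
        coordinate is the maximum \<open>y\<close>, and the other one is
        \<open>y - \<bar>d\<bar>\<close>.\<close>
      define d where "d = x / (1 - y)"
      have x: "x = (1 - y) * d" using y by (simp add: d_def)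
      have "\<bar>d\<bar> \<le> y" using z(4) y by (simp add: d_def abs_divide divide_simps)
      then show ?thesis
      proof (cases "d \<ge> 0")
        case True
        then have "z = F (y, y - d)" using z(1) x by (simp add: F_def)
        then show ?thesis using \<open>\<bar>d\<bar> \<le> y\<close> True z y by (intro image_eqI[of _ _ "(y, y - d)"]) auto
      next
        case False
        then have "z = F (y + d, y)" using z(1) x by (simp add: F_def)
        then show ?thesis using \<open>\<bar>d\<bar> \<le> y\<close> False z y by (intro image_eqI[of _ _ "(y + d, y)"]) auto
      qed
    qed
  qed
  have "convex ?L"
  proof (rule convexI)
    fix z z' :: "real \<times> real" and u v :: real
    assume z: "z \<in> ?L" "z' \<in> ?L" and uv: "0 \<le> u" "0 \<le> v" "u + v = 1"
    obtain x y x' y' where zz: "z = (x, y)" "z' = (x', y')" by (meson surj_pair)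
    have h: "0 \<le> y" "y \<le> 1" "\<bar>x\<bar> \<le> y * (1 - y)" "0 \<le> y'" "y' \<le> 1" "\<bar>x'\<bar> \<le> y' * (1 - y')"
      using z zz by auto
    have "\<bar>u * x + v * x'\<bar> \<le> u * \<bar>x\<bar> + v * \<bar>x'\<bar>"
      using abs_triangle_ineq[of "u * x" "v * x'"] uv by (simp add: abs_mult)
    also have "\<dots> \<le> u * (y * (1 - y)) + v * (y' * (1 - y'))"
      using h uv by (intro add_mono mult_left_mono) auto
    \<comment> \<open>Concavity of \<open>y * (1 - y)\<close>, with an explicit nonnegative
      defect.\<close>
    also have "\<dots> \<le> (u * y + v * y') * (1 - (u * y + v * y'))"
    proof -
      have v: "v = 1 - u" using uv by simp
      have "(u * y + v * y') * (1 - (u * y + v * y')) - (u * (y * (1 - y)) + v * (y' * (1 - y'))) = u * v * (y - y')\<^sup>2"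
        unfolding v by (simp add: power2_eq_square algebra_simps)
      moreover have "0 \<le> u * v * (y - y')\<^sup>2" using uv by simp
      ultimately show ?thesis by linarith
    qed
    finally have "\<bar>u * x + v * x'\<bar> \<le> (u * y + v * y') * (1 - (u * y + v * y'))" .
    moreover have "u * y + v * y' \<le> 1" using convex_bound_le[of y 1 y' u v] h uv by simp
    moreover have "0 \<le> u * y + v * y'" using h uv by simp
    ultimately show "u *\<^sub>R z + v *\<^sub>R z' \<in> ?L" using zz by simp
  qed
  moreover have "compact ?L"
    unfolding im[symmetric] using cont by (intro compact_continuous_image) (auto simp: compact_Times)
  moreover have "interior ?L \<noteq> {}"
  proof -
    \<comment> \<open>On these levels \<open>y * (1 - y)\<close> is at least \<open>3/16\<close>,
      more than the half-width \<open>1/8\<close> of the box.\<close>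
    have "{-1/8<..<1/8} \<times> {1/4<..<3/4} \<subseteq> ?L"
    proof
      fix z :: "real \<times> real" assume "z \<in> {-1/8<..<1/8} \<times> {1/4<..<3/4}"
      then obtain x y where z: "z = (x, y)" "\<bar>x\<bar> < 1/8" "1/4 < y" "y < 3/4" by auto
      have "0 \<le> (y - 1/4) * (3/4 - y)" using z by simp
      moreover have "(y - 1/4) * (3/4 - y) = y * (1 - y) - 3/16" by (simp add: field_simps)
      ultimately have "1/8 \<le> y * (1 - y)" by linarith
      then show "z \<in> ?L" using z by auto
    qed
    moreover have "open ({-1/8<..<1/8::real} \<times> {1/4<..<3/4::real})" by (simp add: open_Times)
    ultimately have "{-1/8<..<1/8} \<times> {1/4<..<3/4} \<subseteq> interior ?L" by (rule interior_maximal)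
    moreover have "(0, 1/2) \<in> {-1/8<..<1/8::real} \<times> {1/4<..<3/4::real}" by simp
    ultimately show ?thesis by blast
  qed
  ultimately show "top_of_set (F ` ({0..1} \<times> {0..1})) homeomorphic_space top_of_set ({0..1/2::real} \<times> {1/2..1::real})"
    unfolding im by (rule homeomorphic_square)
qed

text \<open>The triangle is the square with the side \<open>t = 1\<close> collapsed to one point.\<close>

lemma triangle_model:
  defines "F \<equiv> \<lambda>(s, t). ((1 - t) * s, t :: real)"
  shows "continuous_on ({0..1} \<times> {0..1}) F"
    and "top_of_set (F ` ({0..1} \<times> {0..1})) homeomorphic_space top_of_set ({0..1/2::real} \<times> {1/2..1::real})"
proof -
  show cont: "continuous_on ({0..1} \<times> {0..1}) F"
    unfolding F_def case_prod_beta by (intro continuous_intros)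
  let ?L = "{(x, y). 0 \<le> y \<and> y \<le> 1 \<and> 0 \<le> x \<and> x + y \<le> 1} :: (real \<times> real) set"
  have im: "F ` ({0..1} \<times> {0..1}) = ?L"
  proof (intro equalityI subsetI)
    fix z assume "z \<in> F ` ({0..1} \<times> {0..1})"
    then obtain s t where st: "0 \<le> s" "s \<le> 1" "0 \<le> t" "t \<le> 1" "z = F (s, t)" by auto
    then have "(1 - t) * s \<le> (1 - t) * 1" by (intro mult_left_mono) auto
    then show "z \<in> ?L" using st by (auto simp: F_def)
  next
    fix z assume "z \<in> ?L"
    then obtain x y where z: "z = (x, y)" "0 \<le> y" "y \<le> 1" "0 \<le> x" "x + y \<le> 1" by blast
    show "z \<in> F ` ({0..1} \<times> {0..1})"
    proof (cases "y = 1")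
      case True
      then have "z = F (1, 1)" using z by (simp add: F_def)
      then show ?thesis by auto
    next
      case False
      then have "z = F (x / (1 - y), y)" using z by (simp add: F_def)
      moreover have "x / (1 - y) \<in> {0..1}" using z False by (simp add: divide_simps)
      ultimately show ?thesis using z by auto
    qed
  qed
  have "convex ?L"
  proof (rule convexI)
    fix z z' :: "real \<times> real" and u v :: real
    assume z: "z \<in> ?L" "z' \<in> ?L" and uv: "0 \<le> u" "0 \<le> v" "u + v = 1"
    obtain x y x' y' where zz: "z = (x, y)" "z' = (x', y')" by (meson surj_pair)
    have "u * (x + y) + v * (x' + y') \<le> 1"
      using convex_bound_le[of "x + y" 1 "x' + y'" u v] z zz uv by simp
    moreover have "u * y + v * y' \<le> 1" using convex_bound_le[of y 1 y' u v] z zz uv by simp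
    moreover have "0 \<le> u * y + v * y'" "0 \<le> u * x + v * x'" using z zz uv by simp_all
    ultimately show "u *\<^sub>R z + v *\<^sub>R z' \<in> ?L" using zz by (simp add: algebra_simps)
  qed
  moreover have "compact ?L"
    unfolding im[symmetric] using cont by (intro compact_continuous_image) (auto simp: compact_Times)
  moreover have "interior ?L \<noteq> {}"
  proof -
    have "{0<..<1/2::real} \<times> {0<..<1/2::real} \<subseteq> interior ?L"
      by (rule interior_maximal) (auto simp: open_Times)
    moreover have "(1/4, 1/4) \<in> {0<..<1/2::real} \<times> {0<..<1/2::real}" by simp
    ultimately show ?thesis by blast
  qed
  ultimately show "top_of_set (F ` ({0..1} \<times> {0..1})) homeomorphic_space top_of_set ({0..1/2::real} \<times> {1/2..1::real})"
    unfolding im by (rule homeomorphic_square)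
qed

text \<open>The maximum is 1 exactly if one coordinate is. Below that level the factor
  \<open>1 - max s t\<close> cancels, and maximum and difference together determine the
  pair.\<close>

lemma lens_model_kernel:
  fixes s t s' t' :: real
  assumes "s \<le> 1" "t \<le> 1" "s' \<le> 1" "t' \<le> 1"
  shows "(\<lambda>(s, t). ((1 - max s t) * (s - t), max s t)) (s, t) =
           (\<lambda>(s, t). ((1 - max s t) * (s - t), max s t)) (s', t') \<longleftrightarrow>
         (s = 1 \<or> t = 1) \<and> (s' = 1 \<or> t' = 1) \<or> s = s' \<and> t = t'"
proof (cases "max s t = max s' t'")
  case True
  then show ?thesis using assms by (auto simp: max_def split: if_splits)
next
  case False
  then have "\<not> ((s = 1 \<or> t = 1) \<and> (s' = 1 \<or> t' = 1) \<or> s = s' \<and> t = t')"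
    using assms by (auto simp: max_def split: if_splits)
  then show ?thesis using False by auto
qed

lemma triangle_model_kernel:
  fixes s t s' t' :: real
  shows "(\<lambda>(s, t). ((1 - t) * s, t)) (s, t) = (\<lambda>(s, t). ((1 - t) * s, t)) (s', t') \<longleftrightarrow>
         t = 1 \<and> t' = 1 \<or> s = s' \<and> t = t'"
  by auto

text \<open>The union is at least as close as the worse of its two parts: a point is approximated
  within the part that it comes from.\<close>

lemma continuous_map_Un_hyperspace:
  fixes f g :: "real \<Rightarrow> 'a set"
  assumes X: "continuum X" and f: "f ` {0..1} \<subseteq> subcontinua_at p X" and g: "g ` {0..1} \<subseteq> subcontinua_at p X"
    and cf: "\<And>t e. t \<in> {0..1} \<Longrightarrow> e > 0 \<Longrightarrow>
       \<exists>d>0. \<forall>s\<in>{0..1}. \<bar>s - t\<bar> < d \<longrightarrow> hausdorff_dist X (f s) (f t) \<le> e"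
    and cg: "\<And>t e. t \<in> {0..1} \<Longrightarrow> e > 0 \<Longrightarrow>
       \<exists>d>0. \<forall>s\<in>{0..1}. \<bar>s - t\<bar> < d \<longrightarrow> hausdorff_dist X (g s) (g t) \<le> e"
  shows "continuous_map (top_of_set ({0..1} \<times> {0..1})) (mtopology_of (hyperspace_at p X))
           (\<lambda>(s, t). f s \<union> g t)"
proof (rule continuous_map_hyperspaceI[OF X])
  have UnC: "A \<union> B \<in> subcontinua_at p X" if "A \<in> subcontinua_at p X" "B \<in> subcontinua_at p X" for A B
    using that subcontinuum_Un[of A X B] by (auto simp: subcontinua_at_def)
  show "(\<lambda>(s, t). f s \<union> g t) ` ({0..1} \<times> {0..1}) \<subseteq> subcontinua_at p X"
    using f g UnC by (auto simp: image_subset_iff)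
  fix x :: "real \<times> real" and e :: real assume x: "x \<in> {0..1} \<times> {0..1}" and e: "e > 0"
  obtain s t where st: "x = (s, t)" "s \<in> {0..1}" "t \<in> {0..1}" using x by auto
  \<comment> \<open>The half makes the bound strict for \<open>hausdorff_dist_lessD\<close>; the two
    errors do not add up.\<close>
  obtain d1 where d1: "d1 > 0" "\<And>s'. s' \<in> {0..1} \<Longrightarrow> \<bar>s' - s\<bar> < d1 \<Longrightarrow> hausdorff_dist X (f s') (f s) \<le> e/2"
    using cf[OF st(2), of "e/2"] e by auto
  obtain d2 where d2: "d2 > 0" "\<And>t'. t' \<in> {0..1} \<Longrightarrow> \<bar>t' - t\<bar> < d2 \<Longrightarrow> hausdorff_dist X (g t') (g t) \<le> e/2"
    using cg[OF st(3), of "e/2"] e by auto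
  have near1: "\<exists>b\<in>B. mdist X a b \<le> e"
    if "a \<in> A" "hausdorff_dist X A B \<le> e/2" "A \<in> subcontinua X" "B \<in> subcontinua X" for a A B
  proof -
    have "hausdorff_dist X A B < e" using that(2) e by simp
    then show ?thesis using hausdorff_dist_lessD[OF X that(3,4) _ that(1)] less_imp_le by blast
  qed
  then have near: "\<exists>b\<in>B \<union> B'. mdist X a b \<le> e"
    if "a \<in> A \<union> A'" "hausdorff_dist X A B \<le> e/2" "hausdorff_dist X A' B' \<le> e/2"
      "A \<in> subcontinua X" "B \<in> subcontinua X" "A' \<in> subcontinua X" "B' \<in> subcontinua X" for a A B A' B'
    using near1[OF _ that(2,4,5), of a] near1[OF _ that(3,6,7), of a] that(1) by blast
  interpret Metric_space "mspace X" "mdist X" by simp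
  have main: "hausdorff_dist X (f s' \<union> g t') (f s \<union> g t) \<le> e"
    if s': "s' \<in> {0..1}" "\<bar>s' - s\<bar> < d1" and t': "t' \<in> {0..1}" "\<bar>t' - t\<bar> < d2" for s' t'
  proof -
    have sc: "f s' \<in> subcontinua X" "f s \<in> subcontinua X" "g t' \<in> subcontinua X" "g t \<in> subcontinua X"
      using f g st s'(1) t'(1) by (auto simp: subcontinua_at_def image_subset_iff)
    have "f s' \<union> g t' \<in> subcontinua X" "f s \<union> g t \<in> subcontinua X"
      using f g st s'(1) t'(1) by (auto intro!: subcontinua_atD(1) UnC simp: image_subset_iff)
    then show ?thesis
    proof (rule hausdorff_dist_leI)
      note h = d1(2)[OF s'] d2(2)[OF t']
      show "\<exists>b\<in>f s \<union> g t. mdist X a b \<le> e" if "a \<in> f s' \<union> g t'" for a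
        using near[OF that h] sc by blast
      show "\<exists>a\<in>f s' \<union> g t'. mdist X a b \<le> e" if "b \<in> f s \<union> g t" for b
        using near[OF that h[unfolded hausdorff_dist_commute[OF X, of "f s'"] hausdorff_dist_commute[OF X, of "g t'"]]] sc
          commute[of b] by auto
    qed
  qed
  have "hausdorff_dist X ((\<lambda>(s, t). f s \<union> g t) y) ((\<lambda>(s, t). f s \<union> g t) x) \<le> e"
    if y: "y \<in> {0..1} \<times> {0..1}" "dist y x < min d1 d2" for y
  proof -
    obtain s' t' where y': "y = (s', t')" by fastforce
    have "\<bar>s' - s\<bar> < d1" "\<bar>t' - t\<bar> < d2"
      using dist_fst_le[of y x] dist_snd_le[of y x] st(1) y' y(2) by (auto simp: dist_real_def)
    then show ?thesis using main[of s' t'] y(1) y' st(1) by simp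
  qed
  then show "\<exists>d>0. \<forall>y\<in>{0..1} \<times> {0..1}. dist y x < d \<longrightarrow>
      hausdorff_dist X ((\<lambda>(s, t). f s \<union> g t) y) ((\<lambda>(s, t). f s \<union> g t) x) \<le> e"
    using d1(1) d2(1) by (intro exI[of _ "min d1 d2"]) auto
qed

section \<open>Indecomposable continua with arcs as proper subcontinua\<close>

definition slice :: "'a set \<Rightarrow> ('a \<Rightarrow> real) \<Rightarrow> real \<Rightarrow> real \<Rightarrow> 'a set" where
  "slice Z h a b = {x \<in> Z. a \<le> h x \<and> h x \<le> b}"

text \<open>What is kept of a homeomorphism from \<open>Z\<close> to \<open>{0..1}\<close> is a
  bijection that matches subcontinua with intervals. It is stated with \<open>subcontinua X\<close>,
  so that arguments inside an arc need no subspace topology of \<open>X\<close>.\<close>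

definition arc_coordinate :: "'a metric \<Rightarrow> 'a set \<Rightarrow> ('a \<Rightarrow> real) \<Rightarrow> bool" where
  "arc_coordinate X Z h \<longleftrightarrow> h ` Z = {0..1} \<and> inj_on h Z \<and>
     (\<forall>a b. 0 \<le> a \<and> a \<le> b \<and> b \<le> 1 \<longrightarrow> slice Z h a b \<in> subcontinua X) \<and>
     (\<forall>A \<in> subcontinua X. A \<subseteq> Z \<longrightarrow> (\<exists>a b. 0 \<le> a \<and> a \<le> b \<and> b \<le> 1 \<and> A = slice Z h a b))"

lemma arc_coordinate_exists:
  assumes Z: "Z \<in> subcontinua X" and arc: "arc_space (subtopology (mtopology_of X) Z)"
  shows "\<exists>h. arc_coordinate X Z h"
proof -
  let ?T = "mtopology_of X"
  have ZX: "Z \<subseteq> mspace X" and cZ: "closedin ?T Z"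
    using subcontinua_subset[OF Z] Z by (auto simp: subcontinua_def)
  obtain h where h: "homeomorphic_map (subtopology ?T Z) (mtopology_of unit_interval) h"
    using arc unfolding arc_space_def homeomorphic_space by auto
  have im: "h ` Z = {0..1}" and inj: "inj_on h Z"
    using homeomorphic_imp_surjective_map[OF h] homeomorphic_imp_injective_map[OF h] ZX
    by (simp_all add: Int_absorb1)
  have corr: "A \<in> subcontinua X \<longleftrightarrow> h ` A \<in> subcontinua unit_interval" if A: "A \<subseteq> Z" for A
  proof -
    have "closedin ?T A \<longleftrightarrow> closedin (subtopology ?T Z) A"
      using A cZ closedin_closed_subtopology by blast
    moreover have "connectedin ?T A \<longleftrightarrow> connectedin (subtopology ?T Z) A"
      using A by (simp add: connectedin_subtopology)
    ultimately show ?thesis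
      using homeomorphic_map_closedness[OF h, of A] homeomorphic_map_connectedness[OF h, of A] A ZX
      by (auto simp: subcontinua_def)
  qed
  have "slice Z h a b \<in> subcontinua X" if "0 \<le> a" "a \<le> b" "b \<le> 1" for a b
  proof -
    have "{a..b} \<subseteq> h ` Z" using im that by auto
    then have "h ` slice Z h a b = {a..b}" unfolding slice_def by (fastforce simp: image_iff)
    moreover have "slice Z h a b \<subseteq> Z" by (auto simp: slice_def)
    ultimately show ?thesis using corr that by (auto simp: subcontinua_unit_interval)
  qed
  moreover have "\<exists>a b. 0 \<le> a \<and> a \<le> b \<and> b \<le> 1 \<and> A = slice Z h a b"
    if A: "A \<in> subcontinua X" "A \<subseteq> Z" for A
  proof -
    obtain a b where ab: "h ` A = {a..b}" "0 \<le> a" "a \<le> b" "b \<le> 1"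
      using corr[OF A(2)] A(1) by (auto simp: subcontinua_unit_interval)
    have "x \<in> A" if "x \<in> Z" "h x \<in> h ` A" for x
      using inj that A(2) by (simp add: inj_on_image_mem_iff)
    moreover have "h x \<in> {a..b}" if "x \<in> A" for x using ab(1) that by blast
    ultimately have "A = slice Z h a b" using A(2) unfolding slice_def ab(1) by auto
    then show ?thesis using ab by blast
  qed
  ultimately show ?thesis unfolding arc_coordinate_def using im inj by blast
qed

text \<open>The orientation of an arc is arbitrary; flipping serves to place a chosen branch at
  \<open>p\<close> on the left.\<close>

lemma arc_coordinate_flip:
  assumes "arc_coordinate X Z h"
  shows "arc_coordinate X Z (\<lambda>x. 1 - h x)"
proof -
  have sl: "slice Z (\<lambda>x. 1 - h x) a b = slice Z h (1 - b) (1 - a)" for a b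
    by (auto simp: slice_def)
  have im: "(\<lambda>x. 1 - h x) ` Z = {0..1}"
  proof -
    have "(\<lambda>x. 1 - h x) ` Z = (\<lambda>y. 1 - y) ` h ` Z" by (simp add: image_image)
    also have "\<dots> = {0..1}" using assms by (simp add: arc_coordinate_def image_diff_atLeastAtMost)
    finally show ?thesis .
  qed
  have "inj_on (\<lambda>x. 1 - h x) Z" using assms by (auto simp: arc_coordinate_def inj_on_def)
  moreover have "slice Z (\<lambda>x. 1 - h x) a b \<in> subcontinua X" if "0 \<le> a \<and> a \<le> b \<and> b \<le> 1" for a b
    using assms that unfolding sl arc_coordinate_def by simp
  moreover have "\<exists>a b. 0 \<le> a \<and> a \<le> b \<and> b \<le> 1 \<and> A = slice Z (\<lambda>x. 1 - h x) a b"
    if "A \<in> subcontinua X" "A \<subseteq> Z" for A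
  proof -
    obtain a b where "0 \<le> a \<and> a \<le> b \<and> b \<le> 1 \<and> A = slice Z h a b"
      using assms \<open>A \<in> subcontinua X\<close> \<open>A \<subseteq> Z\<close> unfolding arc_coordinate_def by meson
    then show ?thesis unfolding sl by (intro exI[of _ "1 - b"] exI[of _ "1 - a"]) auto
  qed
  ultimately show ?thesis unfolding arc_coordinate_def using im by blast
qed

lemma arc_coordinate_point:
  assumes "arc_coordinate X Z h" "0 \<le> t" "t \<le> 1"
  shows "\<exists>x\<in>Z. h x = t"
proof -
  have "t \<in> h ` Z" using assms by (auto simp: arc_coordinate_def)
  then show ?thesis by blast
qed

definition proper_at :: "'a metric \<Rightarrow> 'a \<Rightarrow> 'a set set" where
  "proper_at X p = subcontinua_at p X - {mspace X}"

text \<open>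
  If \<open>Q\<close> is an arc with end \<open>p\<close>, these are the proper subcontinua that leave \<open>p\<close> only in the
  direction opposite to \<open>Q\<close>.
\<close>

definition arc_side :: "'a metric \<Rightarrow> 'a \<Rightarrow> 'a set \<Rightarrow> 'a set set" where
  "arc_side X p Q = {A \<in> proper_at X p. A \<inter> Q = {p}}"

locale arc_continuum =
  fixes X :: "'a metric" and p :: 'a
  assumes X: "continuum X" and nd: "\<not> degenerate (mspace X)" and p: "p \<in> mspace X"
    and indec: "indecomposable X" and arcs: "proper_subcontinua_arcs X"
begin

abbreviation "K \<equiv> proper_at X p"
abbreviation "side \<equiv> arc_side X p"

lemma K_D: "A \<in> K \<Longrightarrow> A \<in> subcontinua X" "A \<in> K \<Longrightarrow> p \<in> A" "A \<in> K \<Longrightarrow> A \<noteq> mspace X"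
  by (auto simp: proper_at_def subcontinua_at_def)

lemma K_I: "A \<in> subcontinua X \<Longrightarrow> p \<in> A \<Longrightarrow> A \<noteq> mspace X \<Longrightarrow> A \<in> K"
  by (auto simp: proper_at_def subcontinua_at_def)

lemma K_subset: "A \<in> subcontinua X \<Longrightarrow> p \<in> A \<Longrightarrow> A \<subseteq> B \<Longrightarrow> B \<in> K \<Longrightarrow> A \<in> K"
  using K_D subcontinua_subset by (metis K_I subset_antisym)

text \<open>This is where indecomposability shapes C(p, X): finitely many proper subcontinua through
  \<open>p\<close> lie in a common one, which is an arc unless it is \<open>{p}\<close>, and they
  can be compared in its coordinate.\<close>

lemma K_Un: "A \<in> K \<Longrightarrow> B \<in> K \<Longrightarrow> A \<union> B \<in> K"
proof (rule K_I)
  assume AB: "A \<in> K" "B \<in> K"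
  then have "A \<inter> B \<noteq> {}" using K_D(2) by blast
  then show "A \<union> B \<in> subcontinua X" using AB K_D(1) by (intro subcontinuum_Un) auto
  show "p \<in> A \<union> B" using AB K_D(2) by blast
  show "A \<union> B \<noteq> mspace X"
    using indec AB K_D(1,3) unfolding decomposable_def by (metis Diff_iff singletonD)
qed

lemma singleton_K: "{p} \<in> K"
  using p nd by (intro K_I subcontinuum_singleton) (auto simp: degenerate_def)

lemma K_arc_coordinate:
  assumes "Z \<in> K" "Z \<noteq> {p}"
  shows "\<exists>h. arc_coordinate X Z h"
proof -
  have "\<not> degenerate Z" using assms K_D(2)[OF assms(1)] by (auto simp: degenerate_def)
  then show ?thesis
    using arcs K_D[OF assms(1)] unfolding proper_subcontinua_arcs_def by (intro arc_coordinate_exists) auto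
qed

lemma K_slice:
  assumes h: "arc_coordinate X Z h" and Z: "Z \<in> K" and A: "A \<in> K" "A \<subseteq> Z"
  obtains a b where "0 \<le> a" "a \<le> h p" "h p \<le> b" "b \<le> 1" "A = slice Z h a b"
proof -
  obtain a b where ab: "0 \<le> a \<and> a \<le> b \<and> b \<le> 1 \<and> A = slice Z h a b"
    using h K_D(1)[OF A(1)] A(2) unfolding arc_coordinate_def by meson
  moreover have "p \<in> A" by (rule K_D(2)[OF A(1)])
  ultimately show thesis using that by (auto simp: slice_def)
qed

lemma slice_K:
  assumes h: "arc_coordinate X Z h" and Z: "Z \<in> K" and ab: "0 \<le> a" "a \<le> h p" "h p \<le> b" "b \<le> 1"
  shows "slice Z h a b \<in> K"
proof (rule K_subset[OF _ _ _ Z])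
  show "slice Z h a b \<in> subcontinua X" using h ab unfolding arc_coordinate_def by simp
  show "p \<in> slice Z h a b" using K_D(2)[OF Z] ab by (simp add: slice_def)
qed (auto simp: slice_def)

lemma coordinate_p:
  assumes "arc_coordinate X Z h" "Z \<in> K"
  shows "0 \<le> h p" "h p \<le> 1"
proof -
  have "h p \<in> h ` Z" using K_D(2)[OF assms(2)] by blast
  then show "0 \<le> h p" "h p \<le> 1" using assms(1) by (auto simp: arc_coordinate_def)
qed

section \<open>Opposite directions at \<open>p\<close>\<close>

definition branches :: "'a set \<Rightarrow> 'a set \<Rightarrow> bool" where
  "branches L R \<longleftrightarrow> L \<in> K \<and> R \<in> K \<and> L \<inter> R = {p} \<and> L \<noteq> {p} \<and> R \<noteq> {p}"

lemma branches_sym: "branches L R \<Longrightarrow> branches R L"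
  by (auto simp: branches_def)

text \<open>Branches are arcs that leave \<open>p\<close> in opposite directions. Two incomparable
  sets are proper and, in the coordinate of their union, intervals around \<open>h p\<close> neither
  of which contains the other. Hence \<open>p\<close> is interior to the union and cuts it into
  branches.\<close>

lemma chain_or_branches:
  "chain_of_sets (subcontinua_at p X) \<or> (\<exists>L R. branches L R)"
proof (rule disjCI)
  assume nb: "\<not> (\<exists>L R. branches L R)"
  show "chain_of_sets (subcontinua_at p X)"
    unfolding chain_of_sets_def
  proof (intro ballI, rule ccontr)
    fix A B assume AB: "A \<in> subcontinua_at p X" "B \<in> subcontinua_at p X" and n: "\<not> (A \<subseteq> B \<or> B \<subseteq> A)"
    have "A \<subseteq> mspace X" "B \<subseteq> mspace X"
      using AB by (auto intro!: subcontinua_subset subcontinua_atD(1))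
    then have "A \<noteq> mspace X" "B \<noteq> mspace X" using n by blast+
    then have A: "A \<in> K" and B: "B \<in> K" using AB by (auto simp: proper_at_def)
    let ?Z = "A \<union> B"
    have Z: "?Z \<in> K" by (rule K_Un[OF A B])
    have "?Z \<noteq> {p}" using n K_D(2)[OF A] K_D(2)[OF B] by auto
    then obtain h where h: "arc_coordinate X ?Z h" using K_arc_coordinate[OF Z] by blast
    obtain a b where ab: "0 \<le> a" "a \<le> h p" "h p \<le> b" "b \<le> 1" "A = slice ?Z h a b"
      using K_slice[OF h Z A] by blast
    obtain a' b' where ab': "0 \<le> a'" "a' \<le> h p" "h p \<le> b'" "b' \<le> 1" "B = slice ?Z h a' b'"
      using K_slice[OF h Z B] by blast
    have sub: "slice ?Z h u v \<subseteq> slice ?Z h u' v'" if "u' \<le> u" "v \<le> v'" for u v u' v'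
      using that by (auto simp: slice_def)
    let ?u = "min a a'" and ?v = "max b b'"
    \<comment> \<open>Otherwise both left ends equal \<open>h p\<close>, and intervals with a common
      end are nested.\<close>
    have u: "?u < h p"
    proof (rule ccontr)
      assume "\<not> ?thesis"
      then have "a = a'" using ab ab' by linarith
      moreover have "b \<le> b' \<or> b' \<le> b" by linarith
      ultimately show False using n sub[of a' a b b'] sub[of a a' b' b] unfolding ab(5)[symmetric] ab'(5)[symmetric] by auto
    qed
    have v: "h p < ?v"
    proof (rule ccontr)
      assume "\<not> ?thesis"
      then have "b = b'" using ab ab' by linarith
      moreover have "a \<le> a' \<or> a' \<le> a" by linarith
      ultimately show False using n sub[of a' a b b'] sub[of a a' b' b] unfolding ab(5)[symmetric] ab'(5)[symmetric] by auto
    qed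
    have 1: "slice ?Z h ?u (h p) \<in> K" "slice ?Z h (h p) ?v \<in> K"
      using ab ab' u v by (auto intro!: slice_K[OF h Z])
    have "x = p" if "x \<in> ?Z" "h x = h p" for x
      using h that K_D(2)[OF Z] unfolding arc_coordinate_def inj_on_def by blast
    then have 2: "slice ?Z h ?u (h p) \<inter> slice ?Z h (h p) ?v = {p}"
      using u v K_D(2)[OF Z] by (auto simp: slice_def)
    have "0 \<le> ?u" "?u \<le> 1" "0 \<le> ?v" "?v \<le> 1" using ab(1-4) ab'(1-4) by auto
    then obtain x y where x: "x \<in> ?Z" "h x = ?u" and y: "y \<in> ?Z" "h y = ?v"
      using arc_coordinate_point[OF h] by meson
    have "x \<in> slice ?Z h ?u (h p)" "x \<noteq> p" using x u by (simp_all add: slice_def) auto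
    moreover have "y \<in> slice ?Z h (h p) ?v" "y \<noteq> p" using y v by (simp_all add: slice_def) auto
    ultimately have "branches (slice ?Z h ?u (h p)) (slice ?Z h (h p) ?v)"
      unfolding branches_def using 1 2 by blast
    then show False using nb by blast
  qed
qed

text \<open>The two intervals share only the coordinate \<open>h p\<close>, so at most one of them
  extends to either side of it. Neither is a single point, so each takes exactly one side; the
  coordinate is flipped if \<open>L0\<close> came out on the right.\<close>

lemma branches_coordinate:
  assumes br: "branches L0 R0" and Z: "Z \<in> K" "L0 \<union> R0 \<subseteq> Z"
  obtains h l r where "arc_coordinate X Z h" "0 \<le> l" "l < h p" "h p < r" "r \<le> 1"
    "L0 = slice Z h l (h p)" "R0 = slice Z h (h p) r"
proof -
  have L0: "L0 \<in> K" "L0 \<noteq> {p}" and R0: "R0 \<in> K" "R0 \<noteq> {p}" and I: "L0 \<inter> R0 = {p}"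
    using br by (auto simp: branches_def)
  have "Z \<noteq> {p}" using Z(2) L0 K_D(2)[OF L0(1)] by auto
  then obtain h where h: "arc_coordinate X Z h" using K_arc_coordinate[OF Z(1)] by blast
  obtain l1 l2 where l: "0 \<le> l1" "l1 \<le> h p" "h p \<le> l2" "l2 \<le> 1" "L0 = slice Z h l1 l2"
    using K_slice[OF h Z(1) L0(1)] Z(2) by auto
  obtain r1 r2 where r: "0 \<le> r1" "r1 \<le> h p" "h p \<le> r2" "r2 \<le> 1" "R0 = slice Z h r1 r2"
    using K_slice[OF h Z(1) R0(1)] Z(2) by auto
  \<comment> \<open>Applied below to \<open>max l1 r1\<close> and \<open>min l2 r2\<close>, the ends
    of the intersection of the two intervals.\<close>
  have only_p: "t = h p" if t: "0 \<le> t" "t \<le> 1" "l1 \<le> t" "t \<le> l2" "r1 \<le> t" "t \<le> r2" for t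
  proof -
    obtain x where "x \<in> Z" "h x = t" using arc_coordinate_point[OF h t(1,2)] by blast
    then have "x \<in> L0 \<inter> R0" using l(5) r(5) t by (auto simp: slice_def)
    then show ?thesis using I \<open>h x = t\<close> by simp
  qed
  have left: "l1 = h p \<or> r1 = h p" using only_p[of "max l1 r1"] l r by (auto simp: max_def split: if_splits)
  have right: "l2 = h p \<or> r2 = h p" using only_p[of "min l2 r2"] l r by (auto simp: min_def split: if_splits)
  have single: "slice Z h (h p) (h p) = {p}"
    using h K_D(2)[OF Z(1)] unfolding arc_coordinate_def inj_on_def slice_def by force
  have nL: "\<not> (l1 = h p \<and> l2 = h p)" and nR: "\<not> (r1 = h p \<and> r2 = h p)"
    using single L0(2) R0(2) l(5) r(5) by auto
  show thesis
  proof (cases "l1 = h p")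
    case False
    then have "r1 = h p" using left by blast
    moreover have "l2 = h p" using right nR \<open>r1 = h p\<close> by blast
    ultimately show thesis
      using that[OF h, of l1 r2] False nR l r by auto
  next
    case True
    then have "r2 = h p" using right nL by blast
    have fl: "slice Z (\<lambda>x. 1 - h x) a b = slice Z h (1 - b) (1 - a)" for a b
      by (auto simp: slice_def)
    show thesis
      using that[OF arc_coordinate_flip[OF h], of "1 - l2" "1 - r1"] True \<open>r2 = h p\<close> nL nR l r
      unfolding fl by auto
  qed
qed

text \<open>A dictionary between the sides and the slices that end or start at \<open>h p\<close>.
  Mind the crossing: \<open>side R0\<close> is the side of \<open>L0\<close>, because its members
  meet \<open>R0\<close> only in \<open>p\<close>.\<close>

definition sided :: "'a set \<Rightarrow> 'a set \<Rightarrow> 'a set \<Rightarrow> ('a \<Rightarrow> real) \<Rightarrow> bool" where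
  "sided L0 R0 Z h \<longleftrightarrow> arc_coordinate X Z h \<and>
     (\<forall>A \<in> side R0. A \<subseteq> Z \<longrightarrow> (\<exists>a. A = slice Z h a (h p))) \<and>
     (\<forall>A \<in> side L0. A \<subseteq> Z \<longrightarrow> (\<exists>b. A = slice Z h (h p) b)) \<and>
     (\<forall>a. 0 \<le> a \<and> a \<le> h p \<longrightarrow> slice Z h a (h p) \<in> side R0) \<and>
     (\<forall>b. h p \<le> b \<and> b \<le> 1 \<longrightarrow> slice Z h (h p) b \<in> side L0)"

lemma sided_exists:
  assumes br: "branches L0 R0" and Z: "Z \<in> K" "L0 \<union> R0 \<subseteq> Z"
  shows "\<exists>h. sided L0 R0 Z h"
proof -
  obtain h l r where h: "arc_coordinate X Z h" and lr: "0 \<le> l" "l < h p" "h p < r" "r \<le> 1"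
    and L0: "L0 = slice Z h l (h p)" and R0: "R0 = slice Z h (h p) r"
    by (rule branches_coordinate[OF br Z])
  have pZ: "p \<in> Z" by (rule K_D(2)[OF Z(1)])
  have only: "x = p" if "x \<in> Z" "h x = h p" for x
    using h that pZ unfolding arc_coordinate_def inj_on_def by blast
  have "sided L0 R0 Z h"
    unfolding sided_def
  proof (intro conjI ballI allI impI)
    show "arc_coordinate X Z h" by (rule h)
    show "\<exists>a. A = slice Z h a (h p)" if A: "A \<in> side R0" "A \<subseteq> Z" for A
    proof -
      have AK: "A \<in> K" and AR: "A \<inter> R0 = {p}" using A(1) by (auto simp: arc_side_def)
      obtain a b where ab: "0 \<le> a" "a \<le> h p" "h p \<le> b" "b \<le> 1" "A = slice Z h a b"
        by (rule K_slice[OF h Z(1) AK A(2)])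
      have "0 \<le> min b r" "min b r \<le> 1" using ab(1-4) lr by auto
      \<comment> \<open>This point lies in both \<open>A\<close> and \<open>R0\<close>, so it is
        \<open>p\<close>; as \<open>r > h p\<close>, this forces \<open>b = h p\<close>.\<close>
      then obtain x where x: "x \<in> Z" "h x = min b r" using arc_coordinate_point[OF h] by blast
      have "x \<in> A \<inter> R0" using x ab lr R0 by (auto simp: slice_def)
      then have "b = h p" using x AR lr ab by (auto simp: min_def split: if_splits)
      then show ?thesis using ab(5) by blast
    qed
    show "\<exists>b. A = slice Z h (h p) b" if A: "A \<in> side L0" "A \<subseteq> Z" for A
    proof -
      have AK: "A \<in> K" and AR: "A \<inter> L0 = {p}" using A(1) by (auto simp: arc_side_def)
      obtain a b where ab: "0 \<le> a" "a \<le> h p" "h p \<le> b" "b \<le> 1" "A = slice Z h a b"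
        by (rule K_slice[OF h Z(1) AK A(2)])
      have "0 \<le> max a l" "max a l \<le> 1" using ab(1-4) lr by auto
      then obtain x where x: "x \<in> Z" "h x = max a l" using arc_coordinate_point[OF h] by blast
      have "x \<in> A \<inter> L0" using x ab lr L0 by (auto simp: slice_def)
      then have "a = h p" using x AR lr ab by (auto simp: max_def split: if_splits)
      then show ?thesis using ab(5) by blast
    qed
    show "slice Z h a (h p) \<in> side R0" if a: "0 \<le> a \<and> a \<le> h p" for a
    proof -
      have "slice Z h a (h p) \<inter> R0 = {p}"
        using only pZ a lr unfolding R0 slice_def by force
      then show ?thesis
        using slice_K[OF h Z(1), of a "h p"] a coordinate_p[OF h Z(1)] by (simp add: arc_side_def)
    qed
    show "slice Z h (h p) b \<in> side L0" if b: "h p \<le> b \<and> b \<le> 1" for b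
    proof -
      have "slice Z h (h p) b \<inter> L0 = {p}"
        using only pZ b lr unfolding L0 slice_def by force
      then show ?thesis
        using slice_K[OF h Z(1), of "h p" b] b coordinate_p[OF h Z(1)] by (simp add: arc_side_def)
    qed
  qed
  then show ?thesis by blast
qed

section \<open>The two sides as chains, and their completion\<close>

lemma branches_K: "branches L0 R0 \<Longrightarrow> L0 \<union> R0 \<in> K"
  by (rule K_Un) (auto simp: branches_def)

lemma side_K: "A \<in> side Q \<Longrightarrow> A \<in> K"
  by (simp add: arc_side_def)

text \<open>\<open>A\<close>, \<open>B\<close> and the branches lie in one arc. The branches orient
  it, so that \<open>A\<close> and \<open>B\<close> become slices with the common end
  \<open>h p\<close>.\<close>

lemma side_chain:
  assumes br: "branches L0 R0"
  shows "chain_of_sets (side R0)"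
  unfolding chain_of_sets_def
proof (intro ballI)
  fix A B assume A: "A \<in> side R0" and B: "B \<in> side R0"
  let ?Z = "(A \<union> B) \<union> (L0 \<union> R0)"
  have Z: "?Z \<in> K" "L0 \<union> R0 \<subseteq> ?Z"
    using K_Un[OF K_Un[OF side_K[OF A] side_K[OF B]] branches_K[OF br]] by auto
  obtain h where h: "sided L0 R0 ?Z h"
    using sided_exists[OF br Z] by blast
  have "A \<subseteq> ?Z" "B \<subseteq> ?Z" by auto
  then obtain a b where "A = slice ?Z h a (h p)" "B = slice ?Z h b (h p)"
    using h A B unfolding sided_def by meson
  moreover have "slice ?Z h a (h p) \<subseteq> slice ?Z h b (h p) \<or> slice ?Z h b (h p) \<subseteq> slice ?Z h a (h p)"
    by (cases "a \<le> b") (auto simp: slice_def)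
  ultimately show "A \<subseteq> B \<or> B \<subseteq> A" by metis
qed

text \<open>In a common arc the two sets are slices on opposite sides of \<open>h p\<close>.\<close>

lemma side_inter:
  assumes br: "branches L0 R0" and A: "A \<in> side R0" and B: "B \<in> side L0"
  shows "A \<inter> B = {p}"
proof -
  let ?Z = "(A \<union> B) \<union> (L0 \<union> R0)"
  have Z: "?Z \<in> K" "L0 \<union> R0 \<subseteq> ?Z"
    using K_Un[OF K_Un[OF side_K[OF A] side_K[OF B]] branches_K[OF br]] by auto
  obtain h where h: "sided L0 R0 ?Z h"
    using sided_exists[OF br Z] by blast
  have "A \<subseteq> ?Z" "B \<subseteq> ?Z" by auto
  then obtain a b where ab: "A = slice ?Z h a (h p)" "B = slice ?Z h (h p) b"
    using h A B unfolding sided_def by meson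
  have pAB: "p \<in> A" "p \<in> B" using K_D(2)[OF side_K[OF A]] K_D(2)[OF side_K[OF B]] .
  have "x = p" if x: "x \<in> A" "x \<in> B" for x
  proof -
    have "x \<in> slice ?Z h a (h p)" "x \<in> slice ?Z h (h p) b" using x ab by simp_all
    then have "h x \<le> h p" "h p \<le> h x" by (simp_all add: slice_def)
    then have "h x = h p" by simp
    moreover have "inj_on h ?Z" using h by (simp add: sided_def arc_coordinate_def)
    ultimately show ?thesis using x pAB by (meson UnI1 inj_onD)
  qed
  then show ?thesis using pAB by blast
qed

lemma side_decomposition:
  assumes br: "branches L0 R0" and A: "A \<in> K"
  obtains L R where "L \<in> side R0" "R \<in> side L0" "A = L \<union> R"
proof -
  let ?Z = "A \<union> (L0 \<union> R0)"
  have Z: "?Z \<in> K" "L0 \<union> R0 \<subseteq> ?Z" using K_Un[OF A branches_K[OF br]] by auto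
  obtain h where h: "sided L0 R0 ?Z h"
    using sided_exists[OF br Z] by blast
  then have hc: "arc_coordinate X ?Z h" by (simp add: sided_def)
  have "A \<subseteq> ?Z" by auto
  from K_slice[OF hc Z(1) A this] obtain a b
    where ab: "0 \<le> a" "a \<le> h p" "h p \<le> b" "b \<le> 1" "A = slice ?Z h a b" .
  have "slice ?Z h a b = slice ?Z h a (h p) \<union> slice ?Z h (h p) b"
    using ab(2,3) by (auto simp: slice_def)
  moreover have "slice ?Z h a (h p) \<in> side R0" "slice ?Z h (h p) b \<in> side L0"
    using h ab(1-4) unfolding sided_def by blast+
  ultimately show thesis using that ab(5) by metis
qed

lemma side_subset: "A \<in> subcontinua X \<Longrightarrow> p \<in> A \<Longrightarrow> A \<subseteq> B \<Longrightarrow> B \<in> side Q \<Longrightarrow> A \<in> side Q"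
  using K_subset[of A B] unfolding arc_side_def by blast

text \<open>A side need not be closed under limits, but only the closure \<open>M\<close> of its
  union can be missing, and then it equals \<open>X\<close>. Whether \<open>f 1 = mspace X\<close>
  thus tells unbounded sides from bounded ones.\<close>

lemma side_parametrization:
  assumes br: "branches L0 R0"
  obtains f :: "real \<Rightarrow> 'a set" where
    "side R0 \<subseteq> f ` {0..1}" "f ` {0..1} \<subseteq> side R0 \<union> {mspace X}" "inj_on f {0..1}"
    "\<And>s. s \<in> {0..1} \<Longrightarrow> f s = mspace X \<Longrightarrow> s = 1" "\<And>A. A \<in> side R0 \<Longrightarrow> A \<subseteq> f 1"
    "\<And>t e. t \<in> {0..1} \<Longrightarrow> e > 0 \<Longrightarrow>
       \<exists>d>0. \<forall>s\<in>{0..1}. \<bar>s - t\<bar> < d \<longrightarrow> hausdorff_dist X (f s) (f t) \<le> e"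
proof -
  let ?cl = "\<lambda>S. mtopology_of X closure_of S"
  define M where "M = ?cl (\<Union>(side R0))"
  \<comment> \<open>Inserting \<open>M\<close> changes nothing if the side has a largest member, so
    both cases are treated together.\<close>
  let ?C = "insert M (side R0)"
  have side_sub: "side R0 \<subseteq> subcontinua X" using side_K K_D(1) by blast
  have ps: "p \<in> A" if "A \<in> side R0" for A using side_K[OF that] K_D(2) by blast
  have L0: "L0 \<in> side R0" and pp: "{p} \<in> side R0"
    using br singleton_K K_D(2) by (auto simp: branches_def arc_side_def)
  have cl_sup: "\<Union>\<D> \<subseteq> ?cl (\<Union>\<D>)" if "\<D> \<subseteq> subcontinua X" for \<D>
  proof -
    have "\<Union>\<D> \<subseteq> topspace (mtopology_of X)"
      using that subcontinua_subset[of _ X] unfolding topspace_mtopology_of by blast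
    then show ?thesis by (rule closure_of_subset)
  qed
  have cl_least: "?cl S \<subseteq> B" if "S \<subseteq> B" "B \<in> subcontinua X" for S B
    using that by (intro closure_of_minimal) (auto simp: subcontinua_def)
  \<comment> \<open>A proper limit splits as \<open>L \<union> R\<close>. The members of
    \<open>\<D>\<close> meet \<open>R\<close> only in \<open>p\<close>, so they lie in
    \<open>L\<close>, and their closure does too.\<close>
  have cl_side: "?cl (\<Union>\<D>) \<in> side R0"
    if D: "\<D> \<subseteq> side R0" "\<D> \<noteq> {}" and nX: "?cl (\<Union>\<D>) \<noteq> mspace X" for \<D>
  proof -
    let ?S = "?cl (\<Union>\<D>)"
    have Dsub: "\<D> \<subseteq> subcontinua X" using D side_sub by blast
    have "chain_of_sets \<D>"
      using side_chain[OF br] D(1) unfolding chain_of_sets_def by blast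
    then have S: "?S \<in> subcontinua X" by (rule subcontinuum_closure_Union_chain[OF Dsub D(2)])
    have pS: "p \<in> ?S" using cl_sup[OF Dsub] D ps by blast
    obtain L R where LR: "L \<in> side R0" "R \<in> side L0" "?S = L \<union> R"
      by (rule side_decomposition[OF br K_I[OF S pS nX]])
    have "\<Union>\<D> \<subseteq> L"
    proof
      fix x assume "x \<in> \<Union>\<D>"
      then obtain A where A: "A \<in> \<D>" "x \<in> A" by blast
      then have "x \<in> L \<union> R" using cl_sup[OF Dsub] LR(3) by blast
      moreover have "A \<inter> R = {p}" using side_inter[OF br _ LR(2)] A(1) D(1) by blast
      ultimately show "x \<in> L" using A(2) ps[OF LR(1)] by auto
    qed
    then have "?S \<subseteq> L" using cl_least LR(1) side_sub by blast
    then show ?thesis using side_subset[OF S pS _ LR(1)] by blast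
  qed
  have M: "M \<in> side R0 \<or> M = mspace X"
    using cl_side[OF order_refl] L0 unfolding M_def by blast
  have C_cases: "A \<in> side R0 \<or> A = mspace X \<and> M = mspace X" if "A \<in> ?C" for A
    using that M by blast
  have C_sub: "?C \<subseteq> subcontinua X"
    using M side_sub subcontinuum_mspace[OF X] by auto
  have side_M: "A \<subseteq> M" if "A \<in> side R0" for A
    using cl_sup[OF side_sub] that unfolding M_def by blast
  have C_M: "A \<subseteq> M" if "A \<in> ?C" for A using that side_M by blast
  have ch: "chain_of_sets ?C"
    using side_chain[OF br] side_M unfolding chain_of_sets_def by blast
  have pC: "p \<in> A" if "A \<in> ?C" for A using C_cases[OF that] ps p by blast
  obtain f :: "real \<Rightarrow> 'a set" where f: "f ` {0..1} = ?C"
    "\<And>s t. 0 \<le> s \<Longrightarrow> s < t \<Longrightarrow> t \<le> 1 \<Longrightarrow> f s \<subset> f t"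
    "\<And>t e. t \<in> {0..1} \<Longrightarrow> e > 0 \<Longrightarrow>
       \<exists>d>0. \<forall>s\<in>{0..1}. \<bar>s - t\<bar> < d \<longrightarrow> hausdorff_dist X (f s) (f t) \<le> e"
  proof (rule gapless_chain_parametrization[OF X C_sub ch])
    fix \<D> assume D: "\<D> \<subseteq> ?C" "\<D> \<noteq> {}"
    have Dsub: "\<D> \<subseteq> subcontinua X" using D(1) C_sub by (rule order_trans)
    have Dch: "chain_of_sets \<D>" using ch D(1) unfolding chain_of_sets_def by blast
    have I: "\<Inter>\<D> \<in> subcontinua X" by (rule subcontinuum_Inter_chain[OF X Dsub D(2) Dch])
    have pI: "p \<in> \<Inter>\<D>" using D(1) pC by blast
    show "\<Inter>\<D> \<in> ?C"
    proof (cases "\<exists>A\<in>\<D>. A \<in> side R0")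
      case True
      then obtain A where "A \<in> \<D>" "A \<in> side R0" by blast
      then show ?thesis using side_subset[OF I pI _ \<open>A \<in> side R0\<close>] by blast
    next
      case False
      then have "\<D> = {M}" using D by blast
      then show ?thesis by simp
    qed
    show "?cl (\<Union>\<D>) \<in> ?C"
    proof (cases "M \<in> \<D>")
      case True
      have "M \<in> subcontinua X" using C_sub by blast
      then have "?cl (\<Union>\<D>) \<subseteq> M" using cl_least[of "\<Union>\<D>" M] D(1) C_M by blast
      moreover have "M \<subseteq> ?cl (\<Union>\<D>)" using cl_sup[OF Dsub] True by blast
      ultimately show ?thesis by simp
    next
      case False
      then have Ds: "\<D> \<subseteq> side R0" using D(1) by blast
      show ?thesis
      proof (cases "?cl (\<Union>\<D>) = mspace X")
        case True
        have "?cl (\<Union>\<D>) \<subseteq> M" using Ds unfolding M_def by (intro closure_of_mono) blast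
        then have "M = mspace X" using True C_sub subcontinua_subset[of M X] by blast
        then show ?thesis using True by simp
      next
        case False
        then show ?thesis using cl_side[OF Ds D(2)] by blast
      qed
    qed
  next
    fix A B assume AB: "A \<in> ?C" "B \<in> ?C" "A \<subset> B"
    show "\<exists>Z\<in>?C. A \<subset> Z \<and> Z \<subset> B"
    proof (cases "B \<in> side R0")
      case True
      have "A \<in> subcontinua X" "B \<in> subcontinua X" using AB C_sub by auto
      then obtain Z where Z: "Z \<in> subcontinua X" "A \<subset> Z" "Z \<subset> B"
        using intermediate_subcontinuum[OF X _ _ AB(3)] by blast
      then have "Z \<in> side R0" using side_subset[of Z B] pC[OF AB(1)] True by blast
      then show ?thesis using Z by blast
    next
      case False
      then have B: "B = M" "M = mspace X" using AB(2) C_cases by blast+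
      then have A: "A \<in> side R0" using AB C_cases by blast
      \<comment> \<open>A proper \<open>A\<close> containing the whole side would contain its
        closure \<open>X\<close>. So the side has members beyond \<open>A\<close>, and these are
        still proper.\<close>
      have "\<not> \<Union>(side R0) \<subseteq> A"
        using cl_least[of "\<Union>(side R0)" A] A side_sub AB(3) unfolding B(1) M_def by blast
      then obtain Z where Z: "Z \<in> side R0" "\<not> Z \<subseteq> A" by blast
      then have "A \<subset> Z" using ch A unfolding chain_of_sets_def by blast
      moreover have "Z \<subset> B" using side_M[OF Z(1)] K_D(3)[OF side_K[OF Z(1)]] B by blast
      ultimately show ?thesis using Z(1) by blast
    qed
  next
    show "{p} \<in> ?C" "L0 \<in> ?C" using pp L0 by auto
    show "{p} \<noteq> L0" using br by (auto simp: branches_def)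
  qed (rule that)
  show thesis
  proof
    show "side R0 \<subseteq> f ` {0..1}" "f ` {0..1} \<subseteq> side R0 \<union> {mspace X}"
      unfolding f(1) using M by auto
    show "inj_on f {0..1}"
      by (rule linorder_inj_onI) (use f(2) in \<open>auto simp: psubset_eq\<close>)
    show "A \<subseteq> f 1" if "A \<in> side R0" for A
    proof -
      have "A \<in> f ` {0..1}" unfolding f(1) using that by blast
      then obtain s where "s \<in> {0..1}" "A = f s" by blast
      then show ?thesis using f(2)[of s 1] by (cases "s = 1") auto
    qed
    show "s = 1" if s: "s \<in> {0..1}" "f s = mspace X" for s
    proof (rule ccontr)
      assume "s \<noteq> 1"
      then have "f s \<subset> f 1" using f(2)[of s 1] s by simp
      moreover have "f 1 \<in> ?C" using f(1) by force
      then have "f 1 \<subseteq> mspace X" using C_sub subcontinua_subset by blast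
      ultimately show False using s by blast
    qed
  qed (rule f(3))
qed

text \<open>\<open>L\<close> meets \<open>R'\<close> only in \<open>p\<close>, which gives
  \<open>L \<subseteq> L'\<close>; the other inclusions are symmetric.\<close>

lemma side_Un_unique:
  assumes br: "branches L0 R0" and "L \<in> side R0" "R \<in> side L0" "L' \<in> side R0" "R' \<in> side L0"
    and eq: "L \<union> R = L' \<union> R'"
  shows "L = L' \<and> R = R'"
proof -
  have "L \<inter> R' = {p}" "L' \<inter> R = {p}" using side_inter[OF br] assms by blast+
  moreover have "p \<in> L" "p \<in> R" "p \<in> L'" "p \<in> R'"
    using assms side_K K_D(2) by blast+
  ultimately show ?thesis using eq by blast
qed

text \<open>
  Every element of \<open>C(p, X)\<close> is a union of one element of each completed side, and the only
  ambiguity is that the union is \<open>X\<close> as soon as one of the two parts is.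
\<close>

lemma homeomorphic_hyperspace_branches:
  assumes br: "branches L0 R0"
  shows "mtopology_of (hyperspace_at p X) homeomorphic_space top_of_set ({0..1/2::real} \<times> {1/2..1::real})"
proof -
  obtain f :: "real \<Rightarrow> 'a set" where f:
    "side R0 \<subseteq> f ` {0..1}" "f ` {0..1} \<subseteq> side R0 \<union> {mspace X}" "inj_on f {0..1}"
    "\<And>s. s \<in> {0..1} \<Longrightarrow> f s = mspace X \<Longrightarrow> s = 1" "\<And>A. A \<in> side R0 \<Longrightarrow> A \<subseteq> f 1"
    "\<And>t e. t \<in> {0..1} \<Longrightarrow> e > 0 \<Longrightarrow>
       \<exists>d>0. \<forall>s\<in>{0..1}. \<bar>s - t\<bar> < d \<longrightarrow> hausdorff_dist X (f s) (f t) \<le> e"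
    by (rule side_parametrization[OF br]) (rule that)
  obtain g :: "real \<Rightarrow> 'a set" where g:
    "side L0 \<subseteq> g ` {0..1}" "g ` {0..1} \<subseteq> side L0 \<union> {mspace X}" "inj_on g {0..1}"
    "\<And>s. s \<in> {0..1} \<Longrightarrow> g s = mspace X \<Longrightarrow> s = 1" "\<And>A. A \<in> side L0 \<Longrightarrow> A \<subseteq> g 1"
    "\<And>t e. t \<in> {0..1} \<Longrightarrow> e > 0 \<Longrightarrow>
       \<exists>d>0. \<forall>s\<in>{0..1}. \<bar>s - t\<bar> < d \<longrightarrow> hausdorff_dist X (g s) (g t) \<le> e"
    by (rule side_parametrization[OF branches_sym[OF br]]) (rule that)
  let ?H = "mtopology_of (hyperspace_at p X)" and ?S = "{0..1::real} \<times> {0..1::real}"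
  have XC: "mspace X \<in> subcontinua_at p X"
    using subcontinuum_mspace[OF X] p by (simp add: subcontinua_at_def)
  have side_C: "side Q \<subseteq> subcontinua_at p X" for Q
    by (auto simp: arc_side_def proper_at_def)
  have fC: "f ` {0..1} \<subseteq> subcontinua_at p X" and gC: "g ` {0..1} \<subseteq> subcontinua_at p X"
    using XC side_C[of R0] side_C[of L0] order_trans[OF f(2)] order_trans[OF g(2)] by auto
  have f_side: "f s \<in> side R0" if "s \<in> {0..1}" "f s \<noteq> mspace X" for s
    using subsetD[OF f(2) imageI[OF that(1)]] that(2) by simp
  have g_side: "g s \<in> side L0" if "s \<in> {0..1}" "g s \<noteq> mspace X" for s
    using subsetD[OF g(2) imageI[OF that(1)]] that(2) by simp
  have f_sub: "f s \<subseteq> mspace X" and g_sub: "g s \<subseteq> mspace X" if "s \<in> {0..1}" for s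
    using subsetD[OF fC imageI[OF that]] subsetD[OF gC imageI[OF that]]
    by (simp_all add: subcontinua_subset subcontinua_atD(1))
  \<comment> \<open>Two proper subcontinua through \<open>p\<close> cannot cover the indecomposable
    \<open>X\<close>.\<close>
  have Un_X: "f s \<union> g t = mspace X \<longleftrightarrow> f s = mspace X \<or> g t = mspace X"
    if s: "s \<in> {0..1}" and t: "t \<in> {0..1}" for s t
  proof
    assume eq: "f s \<union> g t = mspace X"
    show "f s = mspace X \<or> g t = mspace X"
    proof (rule ccontr)
      assume "\<not> ?thesis"
      then have "f s \<in> K" "g t \<in> K" using f_side[OF s] g_side[OF t] side_K by simp_all
      then show False using K_D(3)[OF K_Un] eq by blast
    qed
  qed (use f_sub[OF s] g_sub[OF t] in auto)
  \<comment> \<open>If both sides were bounded, \<open>f 1 \<union> g 1\<close> would be the largest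
    proper subcontinuum through \<open>p\<close>, but boundary bumping puts another one between it
    and \<open>X\<close>.\<close>
  have reach: "f 1 = mspace X \<or> g 1 = mspace X"
  proof (rule ccontr)
    assume n: "\<not> ?thesis"
    then have fg: "f 1 \<in> side R0" "g 1 \<in> side L0" using f_side[of 1] g_side[of 1] by auto
    then have U: "f 1 \<union> g 1 \<in> K" by (intro K_Un side_K)
    have "f 1 \<union> g 1 \<subset> mspace X"
      using subcontinua_subset[OF K_D(1)[OF U]] K_D(3)[OF U] by (simp add: psubset_eq)
    then obtain Z where Z: "Z \<in> subcontinua X" "f 1 \<union> g 1 \<subset> Z" "Z \<subset> mspace X"
      using intermediate_subcontinuum[OF X K_D(1)[OF U] subcontinuum_mspace[OF X]] by blast
    then have "Z \<in> K" using K_D(2)[OF U] by (intro K_I) auto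
    then obtain L R where "L \<in> side R0" "R \<in> side L0" "Z = L \<union> R"
      by (rule side_decomposition[OF br])
    then have "Z \<subseteq> f 1 \<union> g 1" using f(5)[of L] g(5)[of R] by auto
    then show False using Z by blast
  qed
  have cover: "\<exists>s\<in>{0..1}. \<exists>t\<in>{0..1}. A = f s \<union> g t" if A: "A \<in> subcontinua_at p X" for A
  proof (cases "A = mspace X")
    case True
    then have "A = f 1 \<union> g 1" using Un_X[of 1 1] reach by simp
    then show ?thesis by force
  next
    case False
    then have "A \<in> K" using A by (simp add: proper_at_def)
    then obtain L R where LR: "L \<in> side R0" "R \<in> side L0" "A = L \<union> R"
      by (rule side_decomposition[OF br])
    obtain s where "s \<in> {0..1}" "L = f s" using f(1) LR(1) by blast
    moreover obtain t where "t \<in> {0..1}" "R = g t" using g(1) LR(2) by blast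
    ultimately show ?thesis using LR(3) by blast
  qed
  have Un_C: "f s \<union> g t \<in> subcontinua_at p X" if "s \<in> {0..1}" "t \<in> {0..1}" for s t
  proof -
    have "f s \<in> subcontinua_at p X" "g t \<in> subcontinua_at p X"
      using subsetD[OF fC imageI[OF that(1)]] subsetD[OF gC imageI[OF that(2)]] .
    then show ?thesis using subcontinuum_Un[of "f s" X "g t"] by (auto simp: subcontinua_at_def)
  qed
  have ker: "f s \<union> g t = f s' \<union> g t' \<longleftrightarrow>
      f s \<union> g t = mspace X \<and> f s' \<union> g t' = mspace X \<or> s = s' \<and> t = t'"
    if st: "s \<in> {0..1}" "t \<in> {0..1}" "s' \<in> {0..1}" "t' \<in> {0..1}" for s t s' t'
  proof
    assume eq: "f s \<union> g t = f s' \<union> g t'"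
    show "f s \<union> g t = mspace X \<and> f s' \<union> g t' = mspace X \<or> s = s' \<and> t = t'"
    proof (cases "f s \<union> g t = mspace X")
      case True
      then show ?thesis using eq by simp
    next
      case False
      then have "f s \<noteq> mspace X" "g t \<noteq> mspace X" "f s' \<noteq> mspace X" "g t' \<noteq> mspace X"
        using Un_X[OF st(1,2)] Un_X[OF st(3,4)] eq by auto
      then have "f s = f s' \<and> g t = g t'"
        using side_Un_unique[OF br _ _ _ _ eq] f_side[OF st(1)] g_side[OF st(2)] f_side[OF st(3)] g_side[OF st(4)]
        by simp
      then show ?thesis using f(3) g(3) st by (auto dest: inj_onD)
    qed
  qed auto
  have eq_X: "f s \<union> g t = mspace X \<longleftrightarrow> f 1 = mspace X \<and> s = 1 \<or> g 1 = mspace X \<and> t = 1"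
    if "s \<in> {0..1}" "t \<in> {0..1}" for s t
    using Un_X[OF that] f(4)[OF that(1)] g(4)[OF that(2)] by metis
  have contf: "continuous_map (top_of_set ?S) ?H (\<lambda>(s, t). f s \<union> g t)"
    by (rule continuous_map_Un_hyperspace[OF X fC gC f(6) g(6)])
  \<comment> \<open>The triangle collapses only the edge of the second parameter; the swapped map
    serves the case in which \<open>f\<close> alone reaches \<open>X\<close>.\<close>
  have contg: "continuous_map (top_of_set ?S) ?H (\<lambda>(s, t). g s \<union> f t)"
    by (rule continuous_map_Un_hyperspace[OF X gC fC g(6) f(6)])
  have topH: "topspace ?H = subcontinua_at p X" using X by simp
  have imf: "(\<lambda>(s, t). f s \<union> g t) ` ?S = topspace ?H"
    unfolding topH
  proof (intro equalityI subsetI)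
    fix A assume "A \<in> subcontinua_at p X"
    then obtain s t where "s \<in> {0..1}" "t \<in> {0..1}" "A = f s \<union> g t" using cover by blast
    then show "A \<in> (\<lambda>(s, t). f s \<union> g t) ` ?S" by (intro image_eqI[of _ _ "(s, t)"]) auto
  qed (use Un_C in auto)
  have img: "(\<lambda>(s, t). g s \<union> f t) ` ?S = topspace ?H"
    unfolding topH
  proof (intro equalityI subsetI)
    fix A assume "A \<in> subcontinua_at p X"
    then obtain s t where "s \<in> {0..1}" "t \<in> {0..1}" "A = f s \<union> g t" using cover by blast
    then show "A \<in> (\<lambda>(s, t). g s \<union> f t) ` ?S" by (intro image_eqI[of _ _ "(t, s)"]) auto
  next
    fix A assume "A \<in> (\<lambda>(s, t). g s \<union> f t) ` ?S"
    then obtain s t where "s \<in> {0..1}" "t \<in> {0..1}" "A = g s \<union> f t" by auto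
    then show "A \<in> subcontinua_at p X" using Un_C[of t s] by (simp add: Un_commute)
  qed
  have comp: "compact ?S" by (simp add: compact_Times)
  \<comment> \<open>What remains in each case is to match the kernel of the union map with that of a
    planar model.\<close>
  note model = homeomorphic_space_trans[OF homeomorphic_space_same_kernel[OF comp _ _ Hausdorff_mtopology_of]]
  consider "f 1 = mspace X" "g 1 = mspace X" | "f 1 \<noteq> mspace X" "g 1 = mspace X"
    | "f 1 = mspace X" "g 1 \<noteq> mspace X"
    using reach by blast
  then show ?thesis
  proof cases
    case 1
    show ?thesis
    proof (rule model[OF contf imf lens_model(1) _ lens_model(2)])
      fix x y assume "x \<in> ?S" "y \<in> ?S"
      then obtain s t s' t' where xy: "x = (s, t)" "y = (s', t')"
        and st: "s \<in> {0..1}" "t \<in> {0..1}" "s' \<in> {0..1}" "t' \<in> {0..1}" by blast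
      have "f s \<union> g t = f s' \<union> g t' \<longleftrightarrow> (s = 1 \<or> t = 1) \<and> (s' = 1 \<or> t' = 1) \<or> s = s' \<and> t = t'"
        unfolding ker[OF st] eq_X[OF st(1,2)] eq_X[OF st(3,4)] using 1 by simp
      then show "(\<lambda>(s, t). f s \<union> g t) x = (\<lambda>(s, t). f s \<union> g t) y \<longleftrightarrow>
          (\<lambda>(s, t). ((1 - max s t) * (s - t), max s t)) x = (\<lambda>(s, t). ((1 - max s t) * (s - t), max s t)) y"
        unfolding xy using lens_model_kernel[of s t s' t'] st by simp
    qed
  next
    case 2
    show ?thesis
    proof (rule model[OF contf imf triangle_model(1) _ triangle_model(2)])
      fix x y assume "x \<in> ?S" "y \<in> ?S"
      then obtain s t s' t' where xy: "x = (s, t)" "y = (s', t')"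
        and st: "s \<in> {0..1}" "t \<in> {0..1}" "s' \<in> {0..1}" "t' \<in> {0..1}" by blast
      have "f s \<union> g t = f s' \<union> g t' \<longleftrightarrow> t = 1 \<and> t' = 1 \<or> s = s' \<and> t = t'"
        unfolding ker[OF st] eq_X[OF st(1,2)] eq_X[OF st(3,4)] using 2 by simp
      then show "(\<lambda>(s, t). f s \<union> g t) x = (\<lambda>(s, t). f s \<union> g t) y \<longleftrightarrow>
          (\<lambda>(s, t). ((1 - t) * s, t)) x = (\<lambda>(s, t). ((1 - t) * s, t)) y"
        unfolding xy using triangle_model_kernel[of s t s' t'] by simp
    qed
  next
    case 3
    show ?thesis
    proof (rule model[OF contg img triangle_model(1) _ triangle_model(2)])
      fix x y assume "x \<in> ?S" "y \<in> ?S"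
      then obtain s t s' t' where xy: "x = (t, s)" "y = (t', s')"
        and st: "s \<in> {0..1}" "t \<in> {0..1}" "s' \<in> {0..1}" "t' \<in> {0..1}" by blast
      have "g t \<union> f s = g t' \<union> f s' \<longleftrightarrow> s = 1 \<and> s' = 1 \<or> t = t' \<and> s = s'"
        unfolding Un_commute[of "g t"] Un_commute[of "g t'"] ker[OF st] eq_X[OF st(1,2)] eq_X[OF st(3,4)]
        using 3 by auto
      then show "(\<lambda>(s, t). g s \<union> f t) x = (\<lambda>(s, t). g s \<union> f t) y \<longleftrightarrow>
          (\<lambda>(s, t). ((1 - t) * s, t)) x = (\<lambda>(s, t). ((1 - t) * s, t)) y"
        unfolding xy using triangle_model_kernel[of t s t' s'] by simp
    qed
  qed
qed

lemma not_unique_hyperspace_at: "\<not> unique_hyperspace_at p X"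
proof (cases "chain_of_sets (subcontinua_at p X)")
  case True
  then show ?thesis by (rule not_unique_hyperspace_at_chain[OF X nd p indec])
next
  case False
  then obtain L R where "branches L R" using chain_or_branches by blast
  \<comment> \<open>Matching the square with \<open>{0..q} \<times> {q..1}\<close> fixes
    \<open>q = 1/2\<close>.\<close>
  from not_unique_hyperspace_atI[OF indec _ homeomorphic_hyperspace_branches[OF this]]
  show ?thesis by simp
qed

end

theorem theorem4p5:
  fixes X :: "'a metric" and p :: 'a
  assumes "continuum X"
    and "\<not> degenerate (mspace X)"
    and "hereditarily_indecomposable X
       \<or> (indecomposable X \<and> (\<nexists>e. end_point X e) \<and> proper_subcontinua_arcs X)
       \<or> (indecomposable X \<and> card {e. end_point X e} = 2 \<and> proper_subcontinua_arcs X)"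
    and "p \<in> mspace X"
  shows "\<not> unique_hyperspace_at p X"
proof (cases "hereditarily_indecomposable X")
  case True
  then show ?thesis
    using assms hereditarily_indecomposable_imp_indecomposable hereditarily_indecomposable_chain
    by (intro not_unique_hyperspace_at_chain) auto
next
  case False
  then interpret arc_continuum X p
    using assms by unfold_locales auto
  show ?thesis by (rule not_unique_hyperspace_at)
qed

end
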